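(* Let $\Omega\subset\mathbb{C}$ be a domain bounded by finitely many analytic curves, and let $z_0\in\Omega$. For each integer $k\ge0$ and $t\ge0$ set $$G_k(t):=\inf\left\{\int_{\{2(k+1)G_\Omega(\cdot,z_0)<-t\}}|F|^2:\ F\in\mathcal{O}(\{2(k+1)G_\Omega(\cdot,z_0)<-t\}),\ (F-1,z_0)\in\mathcal{I}(2(k+1)G_\Omega(\cdot,z_0))_{z_0}\right\}.$$ If $\Omega$ is not a disc ($\Omega$ may be conformally equivalent to a disc), then there exists a large enough $k>0$ such that $-\log G_k(t)$ is not convex on $[0,+\infty)$.
   Context: $G_\Omega(\cdot,z_0)$ is the (negative) Green function of $\Omega$ with pole at $z_0$, normalized so that $G_\Omega(z,z_0)-\log|z-z_0|$ is bounded near $z_0$. $\mathcal{I}(\Phi)$ is the multiplier ideal sheaf, i.e. the sheaf of germs of holomorphic functions $g$ with $|g|^2e^{-\Phi}$ locally integrable. Integrals are with respect to Lebesgue measure. "Disc" means a round (Euclidean) disc in $\mathbb{C}$. *)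

theory Defs
  imports "HOL-Complex_Analysis.Complex_Analysis"
begin

text \<open>Analytic Jordan curves, as in Pommerenke: images of the unit circle under a map that is
  holomorphic and injective on a neighbourhood of the circle.\<close>

definition analytic_Jordan_curve :: "complex set \<Rightarrow> bool" where
  "analytic_Jordan_curve C \<longleftrightarrow>
     (\<exists>A f. open A \<and> sphere 0 1 \<subseteq> A \<and> f holomorphic_on A \<and> inj_on f A \<and> C = f ` sphere 0 1)"

definition domain_bounded_by_analytic_curves :: "complex set \<Rightarrow> bool" where
  "domain_bounded_by_analytic_curves \<Omega> \<longleftrightarrow>
     open \<Omega> \<and> connected \<Omega> \<and>
     (\<exists>\<C>. finite \<C> \<and> (\<forall>C\<in>\<C>. analytic_Jordan_curve C) \<and> frontier \<Omega> = \<Union>\<C>)"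

text \<open>\<open>u\<close> is of class \<open>C\<^sup>2\<close> with vanishing Laplacian: \<open>p\<close>, \<open>q\<close> are its first partial derivatives,
  and \<open>a\<close>, \<open>b\<close>, \<open>c\<close> are \<open>u\<^sub>x\<^sub>x\<close>, \<open>u\<^sub>x\<^sub>y = u\<^sub>y\<^sub>x\<close>, \<open>u\<^sub>y\<^sub>y\<close>.\<close>

definition harmonic_on :: "(complex \<Rightarrow> real) \<Rightarrow> complex set \<Rightarrow> bool" (infix "harmonic'_on" 50) where
  "u harmonic_on S \<longleftrightarrow>
     (\<exists>p q a b c.
        continuous_on S a \<and> continuous_on S b \<and> continuous_on S c \<and>
        (\<forall>z\<in>S.
           (u has_derivative (\<lambda>h. p z * Re h + q z * Im h)) (at z) \<and>
           (p has_derivative (\<lambda>h. a z * Re h + b z * Im h)) (at z) \<and>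
           (q has_derivative (\<lambda>h. b z * Re h + c z * Im h)) (at z) \<and>
           a z + c z = 0))"

text \<open>The Green function, with the sign convention \<open>G < 0\<close>, of a domain all of whose boundary points
  are regular. The value at the pole is \<open>-\<infinity>\<close>; values outside \<open>\<Omega>\<close> are unconstrained. Boundedness away
  from the pole is automatic if \<open>\<Omega>\<close> is bounded and is needed for uniqueness if it is not.\<close>

definition is_Green_function :: "complex set \<Rightarrow> complex \<Rightarrow> (complex \<Rightarrow> ereal) \<Rightarrow> bool" where
  "is_Green_function \<Omega> z\<^sub>0 G \<longleftrightarrow>
     G z\<^sub>0 = -\<infinity> \<and>
     (\<forall>z\<in>\<Omega> - {z\<^sub>0}. \<bar>G z\<bar> \<noteq> \<infinity> \<and> G z < 0) \<and>
     (\<lambda>z. real_of_ereal (G z)) harmonic_on (\<Omega> - {z\<^sub>0}) \<and>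
     (\<exists>M. \<forall>\<^sub>F z in at z\<^sub>0. \<bar>real_of_ereal (G z) - ln (cmod (z - z\<^sub>0))\<bar> \<le> M) \<and>
     (\<forall>\<zeta>\<in>frontier \<Omega>. (G \<longlongrightarrow> 0) (at \<zeta> within \<Omega>)) \<and>
     (\<forall>r>0. bounded ((\<lambda>z. real_of_ereal (G z)) ` (\<Omega> - ball z\<^sub>0 r)))"

definition exp_minus :: "ereal \<Rightarrow> ennreal" where
  "exp_minus x = (if x = -\<infinity> then \<infinity> else if x = \<infinity> then 0 else ennreal (exp (- real_of_ereal x)))"

text \<open>The stalk at \<open>z\<close> of the multiplier ideal sheaf of a (Borel) weight \<open>\<Phi>\<close>. A germ is given by any
  function representing it: membership depends on \<open>g\<close> only near \<open>z\<close>.\<close>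

definition multiplier_ideal_stalk :: "(complex \<Rightarrow> ereal) \<Rightarrow> complex \<Rightarrow> (complex \<Rightarrow> complex) set" where
  "multiplier_ideal_stalk \<Phi> z =
     {g. \<exists>U. open U \<and> z \<in> U \<and> g holomorphic_on U \<and>
           (\<integral>\<^sup>+w\<in>U. ennreal ((cmod (g w))\<^sup>2) * exp_minus (\<Phi> w) \<partial>lborel) < \<infinity>}"

definition sublevel :: "complex set \<Rightarrow> (complex \<Rightarrow> ereal) \<Rightarrow> real \<Rightarrow> complex set" where
  "sublevel \<Omega> \<Phi> t = {z\<in>\<Omega>. \<Phi> z < ereal (- t)}"

definition minimal_L2_integral ::
    "complex set \<Rightarrow> complex \<Rightarrow> (complex \<Rightarrow> ereal) \<Rightarrow> real \<Rightarrow> ennreal" where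
  "minimal_L2_integral \<Omega> z\<^sub>0 \<Phi> t =
     (INF F \<in> {F. F holomorphic_on sublevel \<Omega> \<Phi> t \<and>
                  (\<lambda>z. F z - 1) \<in> multiplier_ideal_stalk \<Phi> z\<^sub>0}.
        \<integral>\<^sup>+z\<in>sublevel \<Omega> \<Phi> t. ennreal ((cmod (F z))\<^sup>2) \<partial>lborel)"

text \<open>For \<open>G\<close> the Green function of \<open>\<Omega>\<close> with pole \<open>z\<^sub>0\<close> this is \<open>G\<^sub>k(t)\<close>. If \<open>\<Omega>\<close> is bounded by
  finitely many analytic curves it is positive and finite for all \<open>t \<ge> 0\<close>, so no information
  is lost by \<^const>\<open>enn2real\<close>.\<close>

definition Green_minimal_integral ::
    "complex set \<Rightarrow> complex \<Rightarrow> (complex \<Rightarrow> ereal) \<Rightarrow> nat \<Rightarrow> real \<Rightarrow> real" where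
  "Green_minimal_integral \<Omega> z\<^sub>0 G k t =
     enn2real (minimal_L2_integral \<Omega> z\<^sub>0 (\<lambda>z. ereal (2 * (real k + 1)) * G z) t)"

end

theory Submission
  imports Defs
begin

text \<open>
  Convexity already fails for large \<open>t\<close>, where the sublevel sets shrink to the pole. Near the pole,
  \<open>G = log |g|\<close> with \<open>g\<close> holomorphic and injective, because a bounded harmonic function on a punctured
  disc extends. Let \<open>f\<close> be the inverse of \<open>g\<close>. Since \<open>G\<close> is bounded away from the pole, every
  sublevel set \<open>{G < -s}\<close> with \<open>s\<close> large is the image \<open>f (B\<^sub>r)\<close> of the disc \<open>B\<^sub>r\<close> with centre \<open>0\<close> and
  radius \<open>r = exp (-s)\<close>, and integrals over it become integrals over \<open>B\<^sub>r\<close>.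

  If \<open>f'\<close> is constant, then \<open>G\<close> is \<open>log |z - z\<^sub>0|\<close> plus a constant near \<open>z\<^sub>0\<close>, hence on all of \<open>\<Omega>\<close> by
  the identity theorem, and \<open>\<Omega>\<close> is a disc with centre \<open>z\<^sub>0\<close>. Otherwise
  \<open>f' w = b + w\<^sup>k q w\<close> with \<open>b \<noteq> 0\<close>, \<open>k \<ge> 1\<close> and \<open>q 0 \<noteq> 0\<close>, and this \<open>k\<close> is the one for which convexity
  fails.

  Let \<open>H = G\<^sub>k\<close> and \<open>r = exp (-t / (2 (k + 1)))\<close>. The competitor \<open>F = 1\<close> gives
  \<open>H t \<le> area (f (B\<^sub>r)) \<le> \<pi> r\<^sup>2 sup |f'|\<^sup>2\<close>, so that the upper limit of \<open>H t / r\<^sup>2\<close> as \<open>t \<rightarrow> \<infinity>\<close> is at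
  most \<open>A = \<pi> |b|\<^sup>2\<close>. On the other hand, a competitor satisfies \<open>F = 1 + O((z - z\<^sub>0)\<^sup>k\<^sup>+\<^sup>1)\<close>, so
  \<open>(F \<circ> f) f'\<close> has the same Taylor coefficients as \<open>f'\<close> up to order \<open>k\<close>. Different powers of \<open>w\<close> are
  orthogonal on \<open>B\<^sub>r\<close>, so the terms \<open>b\<close> and \<open>q 0 w\<^sup>k\<close> give a lower bound for the integral, and
  \<open>H t / r\<^sup>2 > A\<close> for every large \<open>t\<close>. If \<open>-log H\<close> were convex, then so would be \<open>-log (H t / r\<^sup>2)\<close>,
  which differs from it by a linear function; but a convex function that stays strictly below a constant
  cannot tend to that constant.

  The four ingredients are \<open>nn_integral_holomorphic_change_of_variables\<close>,
  \<open>Green_function_conformal_coordinate\<close>, the pair \<open>minimal_L2_integral_le_area\<close> and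
  \<open>minimal_L2_integral_lower_bound\<close>, and \<open>not_convex_neg_ln_of_exponential_asymptotics\<close>.
\<close>

section \<open>Change of variables under injective holomorphic maps\<close>

text \<open>The change of variables formula for Lebesgue integrals lives on \<open>real^2\<close>; the isometry
  below carries it to the complex plane.\<close>

definition complex_of_vec :: "real^2 \<Rightarrow> complex" where
  "complex_of_vec x = Complex (x $ 1) (x $ 2)"

definition vec_of_complex :: "complex \<Rightarrow> real^2" where
  "vec_of_complex z = vector [Re z, Im z]"

lemma vec_complex_inverse [simp]:
  "complex_of_vec (vec_of_complex z) = z" "vec_of_complex (complex_of_vec x) = x"
  by (auto simp: complex_of_vec_def vec_of_complex_def vec_eq_iff forall_2)

lemma linear_vec_complex: "linear complex_of_vec" "linear vec_of_complex"
  by (auto intro!: linearI simp: complex_of_vec_def vec_of_complex_def complex_eq_iff vec_eq_iff forall_2)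

lemma bounded_linear_vec_complex:
  "bounded_linear complex_of_vec" "bounded_linear vec_of_complex"
  using linear_vec_complex by (auto simp: linear_conv_bounded_linear)

lemma borel_measurable_complex_of_vec [measurable]: "complex_of_vec \<in> borel_measurable borel"
  using linear_vec_complex by (auto intro!: borel_measurable_continuous_onI linear_continuous_on
     simp: linear_conv_bounded_linear)

lemma lborel_complex_eq_distr: "(lborel :: complex measure) = distr lborel borel complex_of_vec"
proof (rule lborel_eqI)
  fix l u :: complex assume le: "\<And>b. b \<in> Basis \<Longrightarrow> l \<bullet> b \<le> u \<bullet> b"
  have eq: "complex_of_vec -` box l u = box (vec_of_complex l) (vec_of_complex u)"
    by (auto simp: complex_of_vec_def vec_of_complex_def box_def Basis_complex_def Basis_vec_def
         forall_2 inner_axis UNIV_2)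
  have "emeasure (distr lborel borel complex_of_vec) (box l u)
      = emeasure lborel (box (vec_of_complex l) (vec_of_complex u))"
    by (subst emeasure_distr) (auto simp: eq)
  also have "\<dots> = (\<Prod>b\<in>Basis. (u - l) \<bullet> b)"
  proof -
    have B: "(Basis :: (real^2) set) = {axis 1 1, axis 2 1}"
      by (auto simp: Basis_vec_def UNIV_2)
    have ne: "(axis 1 1 :: real^2) \<noteq> axis 2 1"
      by (simp add: axis_eq_axis)
    have "Re l \<le> Re u" "Im l \<le> Im u"
      using le[of 1] le[of \<i>] by (auto simp: Basis_complex_def)
    then show ?thesis
      using ne by (subst emeasure_lborel_box)
        (auto simp: B Basis_complex_def inner_axis vec_of_complex_def inner_diff_left)
  qed
  finally show "emeasure (distr lborel borel complex_of_vec) (box l u) = (\<Prod>b\<in>Basis. (u - l) \<bullet> b)" .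
qed simp

lemma nn_integral_lborel_complex:
  assumes [measurable]: "u \<in> borel_measurable borel"
  shows "(\<integral>\<^sup>+z. u z \<partial>lborel) = (\<integral>\<^sup>+x. u (complex_of_vec x) \<partial>lborel)"
  by (subst lborel_complex_eq_distr) (simp add: nn_integral_distr)

lemma has_integral_iff_nn_integral_lborel:
  fixes f :: "'a::euclidean_space \<Rightarrow> real"
  assumes "f \<in> borel_measurable borel" "\<And>x. 0 \<le> f x" "0 \<le> r"
  shows "(f has_integral r) UNIV \<longleftrightarrow> (\<integral>\<^sup>+x. f x \<partial>lborel) = ennreal r"
  using nn_integral_has_integral_lborel[OF assms(1,2), of r] nn_integral_has_integral[OF assms(1,2), of r] assms(3)
  by blast

lemma det_complex_mult:
  "det (matrix (\<lambda>h. vec_of_complex (c * complex_of_vec h))) = (cmod c)\<^sup>2"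
  by (simp add: det_2 matrix_def vec_of_complex_def complex_of_vec_def axis_def cmod_power2)
     (simp add: power2_eq_square)

text \<open>The real Jacobian of a holomorphic map is \<open>|g'|\<^sup>2\<close>. The formula is needed also when both sides
  are infinite: it follows from the fact that the two integrands have the same finite integrals.\<close>

lemma nn_integral_holomorphic_change_of_variables:
  fixes u :: "complex \<Rightarrow> real"
  assumes hol: "g holomorphic_on S" and S: "open S" and inj: "inj_on g S"
    and u [measurable]: "u \<in> borel_measurable borel" and nonneg: "\<And>z. 0 \<le> u z"
  shows "(\<integral>\<^sup>+z\<in>g ` S. ennreal (u z) \<partial>lborel) = (\<integral>\<^sup>+w\<in>S. ennreal ((cmod (deriv g w))\<^sup>2 * u (g w)) \<partial>lborel)"
proof -
  define S' where "S' = vec_of_complex ` S"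
  define G where "G = (\<lambda>x. vec_of_complex (g (complex_of_vec x)))"
  have S'_eq: "S' = complex_of_vec -` S"
    unfolding S'_def by (force simp: image_iff)
  have G_image: "G ` S' = complex_of_vec -` (g ` S)"
    unfolding S'_def G_def image_image vec_complex_inverse
    by auto (metis imageI image_image vec_complex_inverse(2))
  have opgS: "open (g ` S)"
    by (rule open_mapping_thm3[OF hol S inj])
  have cont: "continuous_on UNIV complex_of_vec"
    using bounded_linear_vec_complex by (intro linear_continuous_on)
  have opS': "open S'" "open (G ` S')"
    unfolding G_image using S opgS cont by (auto simp: S'_eq intro: open_vimage)
  define v where "v = (\<lambda>x. u (complex_of_vec x))"
  have [measurable]: "v \<in> borel_measurable borel" unfolding v_def by measurable
  define D where "D = (\<lambda>x h. vec_of_complex (deriv g (complex_of_vec x) * complex_of_vec h))"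
  have det: "\<bar>det (matrix (D x))\<bar> = (cmod (deriv g (complex_of_vec x)))\<^sup>2" for x
    unfolding D_def det_complex_mult by simp
  have der: "(G has_derivative D x) (at x within S')" if "x \<in> S'" for x
  proof -
    have "complex_of_vec x \<in> S" using that S'_eq by auto
    then have "(g has_field_derivative deriv g (complex_of_vec x)) (at (complex_of_vec x))"
      using hol S by (simp add: holomorphic_derivI)
    then have 1: "(g has_derivative (*) (deriv g (complex_of_vec x))) (at (complex_of_vec x))"
      by (simp add: has_field_derivative_def)
    have 2: "(complex_of_vec has_derivative complex_of_vec) (at x)"
      using bounded_linear_vec_complex by (simp add: bounded_linear_imp_has_derivative)
    from has_derivative_compose[OF 2 1]
    have "((\<lambda>x. g (complex_of_vec x)) has_derivative (\<lambda>h. deriv g (complex_of_vec x) * complex_of_vec h)) (at x)" .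
    from bounded_linear.has_derivative[OF bounded_linear_vec_complex(2) this]
    show ?thesis unfolding G_def D_def by (rule has_derivative_at_withinI)
  qed
  have injG: "inj_on G S'"
    using inj unfolding G_def S'_eq by (auto simp: inj_on_def) (metis vec_complex_inverse)
  \<comment> \<open>The integrands on both sides, extended by zero to the whole plane.\<close>
  define a where "a = (\<lambda>x. indicator (G ` S') x * v x)"
  define b where "b = (\<lambda>x. indicator S' x * ((cmod (deriv g (complex_of_vec x)))\<^sup>2 * v (G x)))"
  have cS: "continuous_on S (deriv g)" "continuous_on S g"
    using hol S by (auto intro!: holomorphic_on_imp_continuous_on holomorphic_deriv)
  have mS: "(\<lambda>z. indicator S z *\<^sub>R deriv g z) \<in> borel_measurable borel"
     "(\<lambda>z. indicator S z *\<^sub>R g z) \<in> borel_measurable borel"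
    using cS S by (auto intro!: borel_measurable_continuous_on_indicator)
  \<comment> \<open>\<open>b\<close> is Borel because \<open>g\<close> and \<open>deriv g\<close> may be replaced by their extensions by zero outside \<open>S\<close>.\<close>
  have b_eq: "b = (\<lambda>x. indicator S (complex_of_vec x) * 
      ((cmod (indicator S (complex_of_vec x) *\<^sub>R deriv g (complex_of_vec x)))\<^sup>2 * 
        u (indicator S (complex_of_vec x) *\<^sub>R g (complex_of_vec x))))"
    unfolding b_def v_def G_def S'_eq by (auto simp: indicator_def fun_eq_iff)
  have [measurable]: "S \<in> sets borel" "S' \<in> sets borel" "G ` S' \<in> sets borel" "g ` S \<in> sets borel"
    using S opS' opgS by auto
  have ma: "a \<in> borel_measurable borel" unfolding a_def by measurable
  have mb: "b \<in> borel_measurable borel"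
    unfolding b_eq using mS by measurable
  have na: "0 \<le> a x" for x unfolding a_def v_def using nonneg by auto
  have nb: "0 \<le> b x" for x unfolding b_def v_def using nonneg by auto
  have cov: "(a has_integral r) UNIV \<longleftrightarrow> (b has_integral r) UNIV" for r
  proof -
    have 1: "(\<lambda>x. \<bar>det (matrix (D x))\<bar> *\<^sub>R (vec (v (G x))::real^1)) absolutely_integrable_on S' \<and>
           integral S' (\<lambda>x. \<bar>det (matrix (D x))\<bar> *\<^sub>R vec (v (G x))) = (vec r :: real^1)
     \<longleftrightarrow> (\<lambda>x. vec (v x)::real^1) absolutely_integrable_on (G ` S') \<and> integral (G ` S') (\<lambda>x. vec (v x)) = (vec r :: real^1)"
      by (rule has_absolute_integral_change_of_variables)
         (use der injG opS' in \<open>auto intro: lmeasurable_open sets_completionI_sets\<close>)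
    have *: "(\<lambda>x. (cmod (deriv g (complex_of_vec x)))\<^sup>2 * v (G x)) absolutely_integrable_on S' \<and>
           integral S' (\<lambda>x. (cmod (deriv g (complex_of_vec x)))\<^sup>2 * v (G x)) = r
       \<longleftrightarrow> v absolutely_integrable_on (G ` S') \<and> integral (G ` S') v = r"
      using 1 unfolding det by (simp add: absolutely_integrable_on_1_iff integral_on_1_eq)
    have ai: "f absolutely_integrable_on T \<longleftrightarrow> f integrable_on T" if "\<And>x. 0 \<le> f x" for f :: "real^2 \<Rightarrow> real" and T
      using that by (auto intro: nonnegative_absolutely_integrable_1 set_lebesgue_integral_eq_integral(1))
    have **: "((\<lambda>x. (cmod (deriv g (complex_of_vec x)))\<^sup>2 * v (G x)) has_integral r) S' \<longleftrightarrow> (v has_integral r) (G ` S')"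
      using * by (subst (asm) (1 2) ai) (auto simp: v_def nonneg has_integral_iff)
    have "(a has_integral r) UNIV \<longleftrightarrow> (v has_integral r) (G ` S')"
      unfolding a_def by (subst has_integral_restrict_UNIV[of "G ` S'", symmetric])
         (rule has_integral_cong, auto simp: indicator_def)
    moreover have "(b has_integral r) UNIV \<longleftrightarrow> ((\<lambda>x. (cmod (deriv g (complex_of_vec x)))\<^sup>2 * v (G x)) has_integral r) S'"
      unfolding b_def by (subst has_integral_restrict_UNIV[of "S'", symmetric])
         (rule has_integral_cong, auto simp: indicator_def)
    ultimately show ?thesis using ** by blast
  qed
  have "(\<integral>\<^sup>+x. a x \<partial>lborel) = ennreal r \<longleftrightarrow> (\<integral>\<^sup>+x. b x \<partial>lborel) = ennreal r" if "r \<ge> 0" for r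
    using cov[of r] has_integral_iff_nn_integral_lborel[OF ma na that] has_integral_iff_nn_integral_lborel[OF mb nb that]
    by simp
  then have ab: "(\<integral>\<^sup>+x. a x \<partial>lborel) = (\<integral>\<^sup>+x. b x \<partial>lborel)"
    by (metis ennreal_cases)
  have "(\<integral>\<^sup>+z\<in>g ` S. ennreal (u z) \<partial>lborel) = (\<integral>\<^sup>+x. a x \<partial>lborel)"
    by (subst nn_integral_lborel_complex, measurable)
      (auto simp: a_def G_image v_def indicator_def intro!: nn_integral_cong)
  also have "\<dots> = (\<integral>\<^sup>+x. b x \<partial>lborel)" by (rule ab)
  also have "\<dots> = (\<integral>\<^sup>+w\<in>S. ennreal ((cmod (indicator S w *\<^sub>R deriv g w))\<^sup>2 * u (indicator S w *\<^sub>R g w)) \<partial>lborel)"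
    using mS by (subst nn_integral_lborel_complex, measurable)
      (auto simp: b_eq indicator_def intro!: nn_integral_cong)
  also have "\<dots> = (\<integral>\<^sup>+w\<in>S. ennreal ((cmod (deriv g w))\<^sup>2 * u (g w)) \<partial>lborel)"
    by (auto simp: indicator_def intro!: nn_integral_cong)
  finally show ?thesis .
qed

section \<open>Mean values and orthogonality on discs\<close>

lemma lborel_distr_rotation:
  fixes \<omega> :: complex
  assumes "cmod \<omega> = 1"
  shows "distr lborel borel (\<lambda>z. \<omega> * z) = lborel"
proof (rule measure_eqI)
  fix A :: "complex set" assume "A \<in> sets (distr lborel borel (\<lambda>z. \<omega> * z))"
  then have A [measurable]: "A \<in> sets borel" by simp
  have ne: "\<omega> \<noteq> 0" using assms by auto
  have inj: "inj ((*) \<omega>)" using ne by (simp add: inj_on_def)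
  have "z \<in> range ((*) \<omega>)" for z
    using ne by (intro image_eqI[of _ _ "z / \<omega>"]) auto
  then have surj: "range ((*) \<omega>) = UNIV" by blast
  have "emeasure lborel A = (\<integral>\<^sup>+z\<in>range ((*) \<omega>). ennreal (indicator A z) \<partial>lborel)"
    unfolding surj by (simp add: ennreal_indicator)
  also have "\<dots> = (\<integral>\<^sup>+w\<in>UNIV. ennreal ((cmod (deriv ((*) \<omega>) w))\<^sup>2 * indicator A (\<omega> * w)) \<partial>lborel)"
    by (rule nn_integral_holomorphic_change_of_variables) (use inj in \<open>auto intro!: holomorphic_intros\<close>)
  also have "\<dots> = (\<integral>\<^sup>+w. indicator ((*) \<omega> -` A) w \<partial>lborel)"
    using assms by (auto intro!: nn_integral_cong simp: indicator_def)
  also have "\<dots> = emeasure (distr lborel borel (\<lambda>z. \<omega> * z)) A"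
    using measurable_sets_borel[of "(*) \<omega>" borel A]
    by (subst emeasure_distr) (auto simp: vimage_def)
  finally show "emeasure (distr lborel borel (\<lambda>z. \<omega> * z)) A = emeasure lborel A" by simp
qed simp

lemma set_integrable_cball:
  fixes f :: "complex \<Rightarrow> 'a::{banach,second_countable_topology}"
  assumes "continuous_on (cball 0 r) f"
  shows "set_integrable lborel (cball 0 r) f"
  unfolding set_integrable_def using assms by (intro borel_integrable_compact) auto

text \<open>Rotation by the angle \<open>\<pi> / n\<close> preserves the disc and the weight but changes the sign of \<open>w ^ n\<close>.\<close>

lemma integral_cball_monomial:
  assumes n: "n > 0"
  shows "(LINT w:cball 0 r|lborel. complex_of_real (cmod w ^ (2*k)) * w ^ n) = 0" (is "?I = 0")
proof -
  define \<omega> where "\<omega> = cis (pi / real n)"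
  have "\<omega> ^ n = cis (real n * (pi / real n))" unfolding \<omega>_def by (rule Complex.DeMoivre)
  also have "\<dots> = -1" using n by simp
  finally have \<omega>: "cmod \<omega> = 1" "\<omega> ^ n = -1" by (auto simp: \<omega>_def)
  let ?f = "\<lambda>w. indicator (cball 0 r) w *\<^sub>R (complex_of_real (cmod w ^ (2*k)) * w ^ n)"
  have [measurable]: "?f \<in> borel_measurable borel"
    by (intro borel_measurable_continuous_on_indicator) (auto intro!: continuous_intros)
  have "?I = integral\<^sup>L (distr lborel borel (\<lambda>z. \<omega> * z)) ?f"
    unfolding lborel_distr_rotation[OF \<omega>(1)] set_lebesgue_integral_def ..
  also have "\<dots> = (LINT w|lborel. ?f (\<omega> * w))"
    by (rule integral_distr) measurable
  also have "\<dots> = (LINT w|lborel. - ?f w)"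
    using \<omega> by (intro Bochner_Integration.integral_cong) (auto simp: norm_mult power_mult_distrib indicator_def)
  also have "\<dots> = - ?I"
    unfolding set_lebesgue_integral_def by (rule Bochner_Integration.integral_minus)
  finally show ?thesis by simp
qed

text \<open>On a smaller closed disc \<open>h\<close> is a uniform limit of its Taylor polynomials, and these have
  integral zero by the lemma on monomials.\<close>

lemma weighted_mean_value:
  assumes hol: "h holomorphic_on ball 0 R" and r: "0 < r" "r < R" and h0: "h 0 = 0"
  shows "(LINT w:cball 0 r|lborel. complex_of_real (cmod w ^ (2*k)) * h w) = 0" (is "?I = 0")
proof -
  define a where "a = (\<lambda>n. (deriv ^^ n) h 0 / fact n)"
  define P where "P = (\<lambda>n w. \<Sum>i<n. a i * w ^ i)"
  have sums: "(\<lambda>n. a n * w ^ n) sums h w" if "w \<in> ball 0 R" for w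
    using holomorphic_power_series[OF hol that] by (simp add: a_def)
  have "ereal R \<le> conv_radius a"
    using sums r by (subst le_conv_radius_iff[where \<xi>=0]) (auto simp: sums_iff)
  then have "ereal r < conv_radius a"
    using r by (metis ereal_less_eq(3) less_ereal.simps(1) order_less_le_trans)
  from powser_uniform_limit[OF this, of 0]
  have "uniform_limit (cball 0 r) P (\<lambda>w. \<Sum>i. a i * w ^ i) sequentially"
    by (simp add: P_def)
  then have ul: "uniform_limit (cball 0 r) P h sequentially"
    by (rule uniform_limit_cong'[THEN iffD1, rotated 2])
      (use sums r in \<open>auto simp: sums_iff\<close>)
  have conth: "continuous_on (cball 0 r) h"
    using hol r by (auto intro!: holomorphic_on_imp_continuous_on elim: holomorphic_on_subset)
  have intP: "(LINT w:cball 0 r|lborel. complex_of_real (cmod w ^ (2*k)) * P n w) = 0" for n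
  proof -
    have "(LINT w:cball 0 r|lborel. complex_of_real (cmod w ^ (2*k)) * P n w)
        = (LINT w:cball 0 r|lborel. \<Sum>i<n. a i * (complex_of_real (cmod w ^ (2*k)) * w ^ i))"
      by (simp add: P_def sum_distrib_left mult_ac)
    also have "\<dots> = (\<Sum>i<n. (LINT w:cball 0 r|lborel. a i * (complex_of_real (cmod w ^ (2*k)) * w ^ i)))"
      unfolding set_lebesgue_integral_def scaleR_sum_right
      by (rule Bochner_Integration.integral_sum)
        (rule set_integrable_cball[unfolded set_integrable_def], auto intro!: continuous_intros)
    also have "\<dots> = (\<Sum>i<n. a i * (LINT w:cball 0 r|lborel. complex_of_real (cmod w ^ (2*k)) * w ^ i))"
      by simp
    also have "\<dots> = 0"
    proof (rule sum.neutral, rule ballI)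
      fix i assume "i \<in> {..<n}"
      have "a 0 = 0" by (simp add: a_def h0)
      then show "a i * (LINT w:cball 0 r|lborel. complex_of_real (cmod w ^ (2*k)) * w ^ i) = 0"
        using integral_cball_monomial[of i r k] by (cases "i = 0") auto
    qed
    finally show ?thesis .
  qed
  have contP: "continuous_on (cball 0 r) (P n)" for n
    unfolding P_def by (intro continuous_intros)
  have "(\<lambda>n. (LINT w:cball 0 r|lborel. complex_of_real (cmod w ^ (2*k)) * P n w)) \<longlonglongrightarrow> ?I"
    unfolding set_lebesgue_integral_def
  proof (rule tendstoI)
    fix e :: real assume e: "e > 0"
    define m where "m = (LINT w:cball 0 r|lborel. cmod (w::complex) ^ (2*k))"
    have m: "m \<ge> 0" unfolding m_def set_lebesgue_integral_def by (intro integral_nonneg_AE) auto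
    define d where "d = e / (m + 1)"
    have d: "d > 0" "d * m < e" using e m by (auto simp: d_def field_simps)
    let ?c = "\<lambda>w::complex. complex_of_real (cmod w ^ (2*k))"
    have "\<forall>\<^sub>F n in sequentially. \<forall>w\<in>cball 0 r. dist (P n w) (h w) < d"
      using ul d unfolding uniform_limit_iff by blast
    then show "\<forall>\<^sub>F n in sequentially. dist (LINT w|lborel. indicator (cball 0 r) w *\<^sub>R (?c w * P n w))
         (LINT w|lborel. indicator (cball 0 r) w *\<^sub>R (?c w * h w)) < e"
    proof eventually_elim
      case (elim n)
      have "(LINT w|lborel. indicator (cball 0 r) w *\<^sub>R (?c w * P n w)) - (LINT w|lborel. indicator (cball 0 r) w *\<^sub>R (?c w * h w))
         = (LINT w|lborel. indicator (cball 0 r) w *\<^sub>R (?c w * P n w) - indicator (cball 0 r) w *\<^sub>R (?c w * h w))"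
        by (rule Bochner_Integration.integral_diff[symmetric];
            rule set_integrable_cball[unfolded set_integrable_def]; intro continuous_intros contP conth)
      also have "norm \<dots> \<le> (LINT w|lborel. d * (indicator (cball 0 r) w *\<^sub>R cmod (w::complex) ^ (2*k)))"
      proof (rule Bochner_Integration.integral_norm_bound_integral)
        show "integrable lborel (\<lambda>w. indicat_real (cball 0 r) w *\<^sub>R (?c w * P n w) - indicat_real (cball 0 r) w *\<^sub>R (?c w * h w))"
          by (rule Bochner_Integration.integrable_diff;
            rule set_integrable_cball[unfolded set_integrable_def]; intro continuous_intros contP conth)
        show "integrable lborel (\<lambda>w::complex. d * (indicat_real (cball 0 r) w *\<^sub>R cmod w ^ (2 * k)))"
          by (rule integrable_mult_right; rule set_integrable_cball[unfolded set_integrable_def]; intro continuous_intros)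
        show "norm (indicat_real (cball 0 r) w *\<^sub>R (?c w * P n w) - indicat_real (cball 0 r) w *\<^sub>R (?c w * h w))
          \<le> d * (indicat_real (cball 0 r) w *\<^sub>R cmod w ^ (2 * k))" for w
        proof (cases "w \<in> cball 0 r")
          case True
          have "?c w * P n w - ?c w * h w = ?c w * (P n w - h w)" by (simp add: algebra_simps)
          then have "norm (?c w * P n w - ?c w * h w) = cmod w ^ (2*k) * dist (P n w) (h w)"
            by (simp add: norm_mult norm_power dist_norm)
          also have "\<dots> \<le> cmod w ^ (2*k) * d"
            using elim True by (intro mult_left_mono) (auto intro: less_imp_le)
          finally show ?thesis using True by (simp add: mult.commute)
        qed auto
      qed
      also have "\<dots> = d * m" unfolding m_def set_lebesgue_integral_def by simp
      also have "\<dots> < e" by (rule d)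
      finally show ?case by (simp add: dist_norm)
    qed
  qed
  then show ?thesis unfolding intP using LIMSEQ_unique tendsto_const by blast
qed

text \<open>Pythagoras: by the mean value property the cross term between the constant \<open>h 0\<close> and
  \<open>h - h 0\<close> vanishes.\<close>

lemma weighted_square_integral_split:
  assumes hol: "h holomorphic_on ball 0 R" and r: "0 < r" "r < R"
  shows "(LINT w:cball 0 r|lborel. cmod w ^ (2*k) * (cmod (h w))\<^sup>2)
     = (cmod (h 0))\<^sup>2 * (LINT w:cball 0 r|lborel. cmod (w::complex) ^ (2*k))
       + (LINT w:cball 0 r|lborel. cmod w ^ (2*k) * (cmod (h w - h 0))\<^sup>2)"
proof -
  have conth: "continuous_on (cball 0 r) h"
    using hol r by (auto intro!: holomorphic_on_imp_continuous_on elim: holomorphic_on_subset)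
  let ?H = "\<lambda>w. cnj (h 0) * (h w - h 0)"
  have "(LINT w:cball 0 r|lborel. complex_of_real (cmod w ^ (2*k)) * ?H w) = 0"
    by (rule weighted_mean_value[OF _ r]) (use hol in \<open>auto intro!: holomorphic_intros\<close>)
  then have "Re (LINT w:cball 0 r|lborel. complex_of_real (cmod w ^ (2*k)) * ?H w) = 0" by simp
  moreover have "Re (LINT w:cball 0 r|lborel. complex_of_real (cmod w ^ (2*k)) * ?H w)
      = (LINT w:cball 0 r|lborel. cmod w ^ (2*k) * Re (?H w))"
    unfolding set_lebesgue_integral_def
    by (subst integral_Re[symmetric]; (rule set_integrable_cball[unfolded set_integrable_def])?)
       (auto intro!: continuous_intros conth Bochner_Integration.integral_cong)
  ultimately have *: "(LINT w:cball 0 r|lborel. cmod w ^ (2*k) * Re (?H w)) = 0" by simp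
  have pw: "(cmod (h w))\<^sup>2 = (cmod (h 0))\<^sup>2 + (2 * Re (?H w) + (cmod (h w - h 0))\<^sup>2)" for w
    unfolding cmod_power2 by (simp add: power2_eq_square algebra_simps)
  have "(LINT w:cball 0 r|lborel. cmod w ^ (2*k) * (cmod (h w))\<^sup>2)
    = (LINT w:cball 0 r|lborel. (cmod (h 0))\<^sup>2 * cmod w ^ (2*k) + 
       (2 * (cmod w ^ (2*k) * Re (?H w)) + cmod w ^ (2*k) * (cmod (h w - h 0))\<^sup>2))"
    by (subst pw) (simp add: algebra_simps)
  also have "\<dots> = (LINT w:cball 0 r|lborel. (cmod (h 0))\<^sup>2 * cmod w ^ (2*k)) + 
       ((LINT w:cball 0 r|lborel. 2 * (cmod w ^ (2*k) * Re (?H w))) + 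
        (LINT w:cball 0 r|lborel. cmod w ^ (2*k) * (cmod (h w - h 0))\<^sup>2))"
  proof -
    have i: "set_integrable lborel (cball 0 r) (\<lambda>w. (cmod (h 0))\<^sup>2 * cmod w ^ (2*k))"
      "set_integrable lborel (cball 0 r) (\<lambda>w. 2 * (cmod w ^ (2*k) * Re (?H w)))"
      "set_integrable lborel (cball 0 r) (\<lambda>w. cmod w ^ (2*k) * (cmod (h w - h 0))\<^sup>2)"
      by (rule set_integrable_cball; intro continuous_intros conth)+
    show ?thesis
      unfolding set_integral_add(2)[OF i(1) set_integral_add(1)[OF i(2,3)]] set_integral_add(2)[OF i(2,3)] ..
  qed
  also have "\<dots> = (cmod (h 0))\<^sup>2 * (LINT w:cball 0 r|lborel. cmod (w::complex) ^ (2*k))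
       + (LINT w:cball 0 r|lborel. cmod w ^ (2*k) * (cmod (h w - h 0))\<^sup>2)"
    using * by simp
  finally show ?thesis .
qed

definition radial_moment :: "nat \<Rightarrow> real \<Rightarrow> real" where
  "radial_moment k r = (LINT w:cball 0 r|lborel. cmod (w::complex) ^ (2*k))"

lemma radial_moment_0: "r \<ge> 0 \<Longrightarrow> radial_moment 0 r = pi * r\<^sup>2"
  unfolding radial_moment_def set_lebesgue_integral_def
  by (simp add: content_cball unit_ball_vol_2)

lemma radial_moment_mono: "r \<le> s \<Longrightarrow> radial_moment k r \<le> radial_moment k s"
  unfolding radial_moment_def set_lebesgue_integral_def
  by (rule integral_mono; (rule set_integrable_cball[unfolded set_integrable_def]; intro continuous_intros)?)
    (auto simp: indicator_def)

text \<open>The disc \<open>ball (r/2) (r/4)\<close> lies in \<open>cball 0 r\<close> and keeps the distance \<open>r/4\<close> from the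
  origin.\<close>

lemma radial_moment_pos:
  assumes r: "r > 0"
  shows "radial_moment k r > 0"
proof -
  let ?B = "ball (complex_of_real (r/2)) (r/4)"
  have sub: "r/4 \<le> cmod w \<and> cmod w \<le> r" if "w \<in> ?B" for w
  proof -
    have "cmod (complex_of_real (r/2) - w) < r/4" using that by (simp add: dist_norm)
    moreover have "cmod (complex_of_real (r/2)) = r/2" unfolding norm_of_real using r by simp
    ultimately show ?thesis
      using norm_triangle_ineq2[of "complex_of_real (r/2)" w]
        norm_triangle_ineq3[of "complex_of_real (r/2)" w] r by linarith
  qed
  have "0 < (r/4)^(2*k) * measure lborel ?B" using r by simp
  also have "\<dots> = (LINT w|lborel. (r/4)^(2*k) * indicator ?B w)" by simp
  also have "\<dots> \<le> radial_moment k r"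
    unfolding radial_moment_def set_lebesgue_integral_def
  proof (rule integral_mono)
    show "integrable lborel (\<lambda>w::complex. (r/4)^(2*k) * indicat_real ?B w)"
      using emeasure_bounded_finite[of ?B]
      by (intro integrable_mult_right integrable_real_indicator) auto
    show "integrable lborel (\<lambda>w::complex. indicat_real (cball 0 r) w *\<^sub>R cmod w ^ (2 * k))"
      by (rule set_integrable_cball[unfolded set_integrable_def]; intro continuous_intros)
    show "(r/4)^(2*k) * indicat_real ?B w \<le> indicat_real (cball 0 r) w *\<^sub>R cmod w ^ (2 * k)" for w
      using sub[of w] r by (auto simp: indicator_def intro!: power_mono)
  qed
  finally show ?thesis .
qed

text \<open>Two applications of Pythagoras, to \<open>a + w ^ k * h w\<close> with weight \<open>1\<close> and to \<open>h\<close> with weight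
  \<open>|w|\<^bsup>2k\<^esup>\<close>, separate the contributions of the monomials \<open>a\<close> and \<open>h 0 * w ^ k\<close>.\<close>

lemma square_integral_lower_bound_cball:
  assumes hol: "h holomorphic_on ball 0 R" and r: "0 < r" "r < R" and k: "k > 0"
  shows "(LINT w:cball 0 r|lborel. (cmod (a + w ^ k * h w))\<^sup>2)
    \<ge> (cmod a)\<^sup>2 * pi * r\<^sup>2 + (cmod (h 0))\<^sup>2 * radial_moment k r"
proof -
  let ?\<phi> = "\<lambda>w. a + w ^ k * h w"
  have "?\<phi> holomorphic_on ball 0 R" using hol by (intro holomorphic_intros)
  from weighted_square_integral_split[OF this r, of 0]
  have 1: "(LINT w:cball 0 r|lborel. (cmod (?\<phi> w))\<^sup>2) 
     = (cmod a)\<^sup>2 * radial_moment 0 r + (LINT w:cball 0 r|lborel. cmod w ^ (2*k) * (cmod (h w))\<^sup>2)"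
    using k by (simp add: zero_power norm_mult norm_power power_mult_distrib power_even_eq radial_moment_def)
  have "(LINT w:cball 0 r|lborel. cmod w ^ (2*k) * (cmod (h w - h 0))\<^sup>2) \<ge> 0"
    unfolding set_lebesgue_integral_def by (intro integral_nonneg_AE) auto
  with weighted_square_integral_split[OF hol r, of k]
  have "(LINT w:cball 0 r|lborel. cmod w ^ (2*k) * (cmod (h w))\<^sup>2) \<ge> (cmod (h 0))\<^sup>2 * radial_moment k r"
    by (simp add: radial_moment_def)
  with 1 show ?thesis using r by (simp add: radial_moment_0 mult.assoc)
qed

text \<open>Here \<open>h\<close> may be unbounded near the circle of radius \<open>r\<close>, so the estimate is applied on smaller
  discs of radius \<open>s\<close> and \<open>s\<close> tends to \<open>r\<close>. The moment at radius \<open>r / 2\<close> is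
  a positive lower bound for the moments at all \<open>s > r / 2\<close>.\<close>

lemma square_integral_lower_bound:
  assumes hol: "h holomorphic_on ball 0 r" and r: "0 < r" and k: "k > 0"
  shows "(\<integral>\<^sup>+w\<in>ball 0 r. ennreal ((cmod (a + w ^ k * h w))\<^sup>2) \<partial>lborel)
    \<ge> ennreal ((cmod a)\<^sup>2 * pi * r\<^sup>2 + (cmod (h 0))\<^sup>2 * radial_moment k (r / 2))" (is "?I \<ge> _")
proof -
  let ?\<phi> = "\<lambda>w. a + w ^ k * h w"
  define c where "c = (cmod (h 0))\<^sup>2 * radial_moment k (r / 2)"
  have *: "?I \<ge> ennreal ((cmod a)\<^sup>2 * pi * s\<^sup>2 + c)" if s: "r / 2 < s" "s < r" for s
  proof -
    have s0: "0 < s" using s r by auto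
    have cont: "continuous_on (cball 0 s) ?\<phi>"
      using hol s by (intro continuous_intros holomorphic_on_imp_continuous_on)
         (auto elim: holomorphic_on_subset)
    have "(cmod a)\<^sup>2 * pi * s\<^sup>2 + c \<le> (cmod a)\<^sup>2 * pi * s\<^sup>2 + (cmod (h 0))\<^sup>2 * radial_moment k s"
      unfolding c_def using s by (intro add_left_mono mult_left_mono radial_moment_mono) auto
    also have "\<dots> \<le> (LINT w:cball 0 s|lborel. (cmod (?\<phi> w))\<^sup>2)"
      by (rule square_integral_lower_bound_cball[OF hol s0 s(2) k])
    finally have "ennreal ((cmod a)\<^sup>2 * pi * s\<^sup>2 + c) \<le> ennreal (LINT w:cball 0 s|lborel. (cmod (?\<phi> w))\<^sup>2)"
      by (rule ennreal_leI)
    also have "\<dots> = (\<integral>\<^sup>+w. ennreal (indicator (cball 0 s) w *\<^sub>R (cmod (?\<phi> w))\<^sup>2) \<partial>lborel)"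
      unfolding set_lebesgue_integral_def
      by (rule nn_integral_eq_integral[symmetric]; (rule set_integrable_cball[unfolded set_integrable_def])?)
         (auto intro!: continuous_intros cont)
    also have "\<dots> \<le> ?I"
      using s by (intro nn_integral_mono) (auto simp: indicator_def)
    finally show ?thesis .
  qed
  have "((\<lambda>s. ennreal ((cmod a)\<^sup>2 * pi * s\<^sup>2 + c)) \<longlongrightarrow> ennreal ((cmod a)\<^sup>2 * pi * r\<^sup>2 + c)) (at_left r)"
    by (intro tendsto_ennrealI tendsto_intros)
  moreover have "\<forall>\<^sub>F s in at_left r. ennreal ((cmod a)\<^sup>2 * pi * s\<^sup>2 + c) \<le> ?I"
    using eventually_at_left_real[of "r/2" r] r by (auto elim!: eventually_mono intro: *)
  ultimately show ?thesis unfolding c_def[symmetric]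
    by (rule tendsto_upperbound) simp
qed

section \<open>The Green function near its pole\<close>

text \<open>\<open>Q = u\<^sub>x - i u\<^sub>y\<close>: its Cauchy-Riemann equations are the symmetry of the second derivatives and
  \<open>\<Delta>u = 0\<close>. The differential of \<open>u\<close> is then the real part of \<open>Q dz\<close>, which is how gradients are
  written throughout.\<close>

lemma harmonic_on_imp_holomorphic_gradient:
  assumes "u harmonic_on S" "open S"
  obtains Q where "Q holomorphic_on S"
    "\<And>z. z \<in> S \<Longrightarrow> (u has_derivative (\<lambda>h. Re (Q z * h))) (at z)"
proof -
  obtain p q a b c where H: "\<And>z. z \<in> S \<Longrightarrow>
           (u has_derivative (\<lambda>h. p z * Re h + q z * Im h)) (at z) \<and>
           (p has_derivative (\<lambda>h. a z * Re h + b z * Im h)) (at z) \<and>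
           (q has_derivative (\<lambda>h. b z * Re h + c z * Im h)) (at z) \<and>
           a z + c z = 0"
    using assms(1) unfolding harmonic_on_def by blast
  define Q where "Q = (\<lambda>z. complex_of_real (p z) - \<i> * complex_of_real (q z))"
  have "(Q has_field_derivative Complex (a z) (- b z)) (at z)" if z: "z \<in> S" for z
  proof -
    have "(Q has_derivative (\<lambda>h. complex_of_real (a z * Re h + b z * Im h)
        - \<i> * complex_of_real (b z * Re h + c z * Im h))) (at z)"
      unfolding Q_def using H[OF z] by (auto intro!: derivative_eq_intros)
    moreover have "c z = - a z" using H[OF z] by simp
    then have "(\<lambda>h. complex_of_real (a z * Re h + b z * Im h)
        - \<i> * complex_of_real (b z * Re h + c z * Im h)) = (*) (Complex (a z) (- b z))"
      by (auto simp: complex_eq_iff fun_eq_iff algebra_simps)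
    ultimately show ?thesis by (simp add: has_field_derivative_def)
  qed
  then have "Q holomorphic_on S"
    using assms(2) holomorphic_on_open by blast
  moreover have "(u has_derivative (\<lambda>h. Re (Q z * h))) (at z)" if "z \<in> S" for z
  proof -
    have "(\<lambda>h. p z * Re h + q z * Im h) = (\<lambda>h. Re (Q z * h))"
      by (auto simp: Q_def)
    then show ?thesis using H[OF that] by metis
  qed
  ultimately show ?thesis using that by blast
qed

lemma has_derivative_ln_cmod:
  assumes "z \<noteq> a"
  shows "((\<lambda>z. ln (cmod (z - a))) has_derivative (\<lambda>h. Re (1 / (z - a) * h))) (at z)"
proof -
  have "((\<lambda>z. z - a) has_derivative (\<lambda>h. h)) (at z)" by (auto intro!: derivative_eq_intros)
  from has_derivative_compose[OF this has_derivative_norm]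
  have n: "((\<lambda>z. cmod (z - a)) has_derivative (\<lambda>h. inner h (sgn (z - a)))) (at z)"
    using assms by (simp add: inner_commute)
  have "(ln has_derivative (*) (inverse (cmod (z - a)))) (at (cmod (z - a)))"
    using assms DERIV_ln[of "cmod (z - a)"] by (simp add: has_field_derivative_def)
  from has_derivative_compose[OF n this]
  have "((\<lambda>z. ln (cmod (z - a))) has_derivative (\<lambda>h. inverse (cmod (z - a)) * inner h (sgn (z - a)))) (at z)" .
  moreover have "inverse (cmod (z - a)) * inner h (sgn (z - a)) = Re (1 / (z - a) * h)" for h
  proof -
    define w where "w = z - a"
    have "w \<noteq> 0" using assms by (simp add: w_def)
    have "inverse (cmod w) * inner h (sgn w) = inner h w / (cmod w)\<^sup>2"
      by (simp add: sgn_div_norm power2_eq_square field_simps)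
    also have "\<dots> = Re (1 / w * h)"
      by (simp add: Re_divide inner_complex_def cmod_power2 algebra_simps add_divide_distrib)
    finally show ?thesis by (simp add: w_def)
  qed
  ultimately show ?thesis by simp
qed

lemma has_derivative_Re_primitive:
  assumes "(W has_field_derivative D) (at z)"
  shows "((\<lambda>z. Re (W z)) has_derivative (\<lambda>h. Re (D * h))) (at z)"
  using assms unfolding has_field_derivative_def
  by (intro bounded_linear.has_derivative[OF bounded_linear_Re])

text \<open>On the largest disc about \<open>z\<close> that avoids \<open>a\<close>, the function \<open>v\<close> is the real part of a
  holomorphic function \<open>W\<close>. As \<open>|exp W| = exp v\<close> lies between \<open>exp (- M)\<close> and \<open>exp M\<close>, Cauchy's
  inequality for \<open>exp W\<close> bounds \<open>|W'| = |P|\<close> by a multiple of \<open>1 / |z - a|\<close>.\<close>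

lemma gradient_bound_near_puncture:
  assumes hol: "P holomorphic_on ball a \<rho> - {a}"
    and der: "\<And>z. z \<in> ball a \<rho> - {a} \<Longrightarrow> (v has_derivative (\<lambda>h. Re (P z * h))) (at z)"
    and bdd: "\<And>z. z \<in> ball a \<rho> - {a} \<Longrightarrow> \<bar>v z\<bar> \<le> M"
    and z: "z \<noteq> a" "cmod (z - a) < \<rho> / 2"
  shows "cmod ((z - a) * P z) \<le> 2 * exp (2 * M)"
proof -
  define d where "d = cmod (z - a)"
  have d: "d > 0" "2 * d < \<rho>" using z by (auto simp: d_def)
  have sub: "ball z d \<subseteq> ball a \<rho> - {a}"
  proof
    fix w assume w: "w \<in> ball z d"
    have "dist a w \<le> dist a z + dist z w" by (rule dist_triangle)
    also have "\<dots> < 2 * d" using w by (simp add: d_def dist_norm norm_minus_commute)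
    finally have "w \<in> ball a \<rho>" using d by simp
    moreover have "w \<noteq> a" using w by (auto simp: d_def dist_norm)
    ultimately show "w \<in> ball a \<rho> - {a}" by simp
  qed
  have "P holomorphic_on ball z d" using hol sub by (rule holomorphic_on_subset)
  then obtain W0 where W0: "\<And>x. x \<in> ball z d \<Longrightarrow> (W0 has_field_derivative P x) (at x within ball z d)"
    using holomorphic_convex_primitive'[OF convex_ball open_ball] by blast
  then have W0': "(W0 has_field_derivative P x) (at x)" if "x \<in> ball z d" for x
    using that by (metis at_within_open open_ball)
  have "\<exists>c. \<forall>x\<in>ball z d. v x - Re (W0 x) = c"
  proof (rule has_derivative_zero_constant)
    fix x assume x: "x \<in> ball z d"
    then have "x \<in> ball a \<rho> - {a}" using sub by blast
    from has_derivative_diff[OF der[OF this] has_derivative_Re_primitive[OF W0'[OF x]]]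
    show "((\<lambda>x. v x - Re (W0 x)) has_derivative (\<lambda>h. 0)) (at x within ball z d)"
      by (simp add: has_derivative_at_withinI)
  qed simp
  then obtain c where c: "\<And>x. x \<in> ball z d \<Longrightarrow> v x = Re (W0 x) + c" by (auto simp: algebra_simps)
  define E where "E = (\<lambda>x. exp (W0 x + complex_of_real c))"
  have normE: "cmod (E x) = exp (v x)" if "x \<in> ball z d" for x
    using c[OF that] by (simp add: E_def)
  have dE: "(E has_field_derivative P x * E x) (at x)" if "x \<in> ball z d" for x
    unfolding E_def using W0'[OF that] by (auto intro!: derivative_eq_intros)
  then have holE: "E holomorphic_on ball z d"
    using holomorphic_on_open open_ball by blast
  have "cmod ((deriv ^^ 1) E z) \<le> fact 1 * exp M / (d/2)^1"
  proof (rule Cauchy_inequality)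
    show "E holomorphic_on ball z (d/2)"
      using holE d by (auto elim!: holomorphic_on_subset)
    show "continuous_on (cball z (d/2)) E"
      using holE d by (auto intro!: holomorphic_on_imp_continuous_on elim!: holomorphic_on_subset)
    fix x assume "cmod (z - x) = d/2"
    then have "x \<in> ball z d" using d by (simp add: dist_norm)
    then have "cmod (E x) = exp (v x)" and "x \<in> ball a \<rho> - {a}" using normE sub by blast+
    then show "cmod (E x) \<le> exp M" using bdd[of x] by simp
  qed (use d in auto)
  moreover have "deriv E z = P z * E z" using dE[of z] d by (simp add: DERIV_imp_deriv)
  ultimately have "cmod (P z) * exp (v z) \<le> 2 * exp M / d"
    using normE[of z] d by (simp add: norm_mult field_simps)
  moreover have "exp (- M) \<le> exp (v z)"
    using bdd[of z] sub d by (auto simp: subset_iff abs_le_iff)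
  ultimately have "cmod (P z) * exp (- M) \<le> 2 * exp M / d"
    by (meson mult_left_mono norm_ge_zero order_trans)
  then have "d * cmod (P z) * exp (- M) \<le> 2 * exp M"
    using d by (simp add: field_simps)
  then have "d * cmod (P z) * exp (- M) * exp M \<le> 2 * exp M * exp M"
    by (rule mult_right_mono) simp
  also have "d * cmod (P z) * exp (- M) * exp M = d * cmod (P z)"
    by (simp add: exp_minus)
  also have "2 * exp M * exp M = 2 * exp (2 * M)"
    by (simp flip: exp_add add: mult.assoc)
  finally show ?thesis by (simp add: norm_mult d_def)
qed

lemma bounded_affine_imp_slope_zero:
  fixes A b B :: real
  assumes "\<And>t. t > 0 \<Longrightarrow> \<bar>A + t * b\<bar> \<le> B"
  shows "b = 0"
proof (rule ccontr)
  assume "b \<noteq> 0"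
  define t where "t = (\<bar>A\<bar> + \<bar>B\<bar> + 1) / \<bar>b\<bar>"
  have "t > 0" using \<open>b \<noteq> 0\<close> by (simp add: t_def add_nonneg_pos)
  have "\<bar>t * b\<bar> = \<bar>A\<bar> + \<bar>B\<bar> + 1"
    using \<open>b \<noteq> 0\<close> \<open>t > 0\<close> by (simp add: abs_mult) (simp add: t_def)
  with assms[OF \<open>t > 0\<close>] show False by linarith
qed

text \<open>In the coordinate \<open>z = a + exp \<zeta>\<close> on a left half plane, \<open>y\<close> has the constant gradient \<open>\<alpha>\<close>,
  so it is \<open>Re (\<alpha> \<zeta>)\<close> up to a constant. The half plane contains a ray to the left and vertical lines, so
  boundedness excludes both a logarithmic term (\<open>Re \<alpha> \<noteq> 0\<close>) and a multivalued argument term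
  (\<open>Im \<alpha> \<noteq> 0\<close>).\<close>

lemma bounded_potential_has_no_log_pole:
  assumes \<rho>: "\<rho> > 0"
    and der: "\<And>z. z \<in> ball a \<rho> - {a} \<Longrightarrow> (y has_derivative (\<lambda>h. Re (\<alpha> / (z - a) * h))) (at z)"
    and bdd: "\<And>z. z \<in> ball a \<rho> - {a} \<Longrightarrow> \<bar>y z\<bar> \<le> M"
  shows "\<alpha> = 0"
proof -
  define H where "H = {\<zeta>. Re \<zeta> < ln \<rho>}"
  have mem: "a + exp \<zeta> \<in> ball a \<rho> - {a}" if "\<zeta> \<in> H" for \<zeta>
  proof -
    have "exp (Re \<zeta>) < exp (ln \<rho>)" using that by (simp add: H_def)
    then have "exp (Re \<zeta>) < \<rho>" using \<rho> by simp
    then show ?thesis by (simp add: dist_norm)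
  qed
  have "\<exists>c. \<forall>\<zeta>\<in>H. y (a + exp \<zeta>) - Re (\<alpha> * \<zeta>) = c"
  proof (rule has_derivative_zero_constant)
    show "convex H" unfolding H_def by (rule convex_halfspace_Re_lt)
    fix \<zeta> assume "\<zeta> \<in> H"
    note m = mem[OF this]
    have 1: "((\<lambda>\<zeta>. a + exp \<zeta>) has_derivative (\<lambda>h. exp \<zeta> * h)) (at \<zeta>)"
      by (auto intro!: derivative_eq_intros)
    have 2: "((\<lambda>\<zeta>. y (a + exp \<zeta>)) has_derivative (\<lambda>h. Re (\<alpha> / (a + exp \<zeta> - a) * (exp \<zeta> * h)))) (at \<zeta>)"
      using has_derivative_compose[OF 1 der[OF m]] .
    have 3: "((\<lambda>\<zeta>. Re (\<alpha> * \<zeta>)) has_derivative (\<lambda>h. Re (\<alpha> * h))) (at \<zeta>)"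
      by (auto intro!: derivative_eq_intros)
    from has_derivative_diff[OF 2 3]
    show "((\<lambda>\<zeta>. y (a + exp \<zeta>) - Re (\<alpha> * \<zeta>)) has_derivative (\<lambda>h. 0)) (at \<zeta> within H)"
      by (simp add: has_derivative_at_withinI)
  qed
  then obtain c where c: "\<And>\<zeta>. \<zeta> \<in> H \<Longrightarrow> y (a + exp \<zeta>) - Re (\<alpha> * \<zeta>) = c" by blast
  have B: "\<bar>Re (\<alpha> * \<zeta>)\<bar> \<le> M + \<bar>c\<bar>" if "\<zeta> \<in> H" for \<zeta>
    using c[OF that] bdd[OF mem[OF that]] by linarith
  have "- Re \<alpha> = 0"
  proof (rule bounded_affine_imp_slope_zero)
    fix t :: real assume "t > 0"
    then have "complex_of_real (ln \<rho> - t) \<in> H" by (simp add: H_def)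
    from B[OF this] show "\<bar>Re \<alpha> * ln \<rho> + t * (- Re \<alpha>)\<bar> \<le> M + \<bar>c\<bar>"
      by (simp add: algebra_simps)
  qed
  moreover have "- Im \<alpha> = 0"
  proof (rule bounded_affine_imp_slope_zero)
    fix t :: real assume "t > 0"
    have "Complex (ln \<rho> - 1) t \<in> H" by (simp add: H_def)
    from B[OF this] show "\<bar>Re \<alpha> * (ln \<rho> - 1) + t * (- Im \<alpha>)\<bar> \<le> M + \<bar>c\<bar>"
      by (simp add: algebra_simps)
  qed
  ultimately show ?thesis by (simp add: complex_eq_iff)
qed

text \<open>By the gradient bound, \<open>P\<close> has at most a simple pole at \<open>a\<close>, and its residue vanishes by the
  preceding lemma once the holomorphic part of \<open>P\<close> is integrated and subtracted.\<close>

lemma bounded_harmonic_removable_singularity: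
  assumes \<rho>: "\<rho> > 0" and hol: "P holomorphic_on ball a \<rho> - {a}"
    and der: "\<And>z. z \<in> ball a \<rho> - {a} \<Longrightarrow> (v has_derivative (\<lambda>h. Re (P z * h))) (at z)"
    and bdd: "\<And>z. z \<in> ball a \<rho> - {a} \<Longrightarrow> \<bar>v z\<bar> \<le> M"
  shows "\<exists>W. W holomorphic_on ball a \<rho> \<and> (\<forall>z\<in>ball a \<rho> - {a}. v z = Re (W z))"
proof -
  have "\<forall>\<^sub>F z in at a. cmod ((z - a) * P z) \<le> 2 * exp (2 * M)"
    unfolding eventually_at using gradient_bound_near_puncture[OF hol der bdd] \<rho>
    by (intro exI[of _ "\<rho>/2"]) (auto simp: dist_norm)
  then have "\<exists>g. g holomorphic_on ball a \<rho> \<and> (\<forall>z\<in>ball a \<rho> - {a}. g z = (z - a) * P z)"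
    using \<rho> hol by (subst holomorphic_on_extend_bounded) (auto intro!: holomorphic_intros)
  then obtain g where g: "g holomorphic_on ball a \<rho>" "\<And>z. z \<in> ball a \<rho> - {a} \<Longrightarrow> g z = (z - a) * P z"
    by blast
  define p where "p = (\<lambda>z. if z = a then deriv g a else (g z - g a) / (z - a))"
  have "p holomorphic_on ball a \<rho>"
    unfolding p_def by (rule pole_lemma_open[OF g(1)]) simp
  then obtain W where W0: "\<And>x. x \<in> ball a \<rho> \<Longrightarrow> (W has_field_derivative p x) (at x within ball a \<rho>)"
    using holomorphic_convex_primitive'[OF convex_ball open_ball] by blast
  then have W: "(W has_field_derivative p x) (at x)" if "x \<in> ball a \<rho>" for x
    using that by (metis at_within_open open_ball)
  have holW: "W holomorphic_on ball a \<rho>" using W holomorphic_on_open open_ball by blast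
  have P_eq: "P z = g a / (z - a) + p z" if "z \<in> ball a \<rho> - {a}" for z
  proof -
    have "P z = g z / (z - a)" using g(2)[OF that] that by simp
    also have "\<dots> = g a / (z - a) + p z" using that by (simp add: p_def diff_divide_distrib)
    finally show ?thesis .
  qed
  have dery: "((\<lambda>z. v z - Re (W z)) has_derivative (\<lambda>h. Re (g a / (z - a) * h))) (at z)"
    if z: "z \<in> ball a \<rho> - {a}" for z
  proof -
    have "z \<in> ball a \<rho>" using z by simp
    from has_derivative_diff[OF der[OF z] has_derivative_Re_primitive[OF W[OF this]]]
    show ?thesis by (simp add: P_eq[OF z] algebra_simps)
  qed
  have "continuous_on (cball a (\<rho>/2)) W"
    using holW \<rho> by (auto intro!: holomorphic_on_imp_continuous_on elim: holomorphic_on_subset)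
  then have "compact (W ` cball a (\<rho>/2))" by (intro compact_continuous_image) auto
  then obtain B where B: "\<And>z. z \<in> cball a (\<rho>/2) \<Longrightarrow> cmod (W z) \<le> B"
    using compact_imp_bounded bounded_iff by (metis imageI)
  have "g a = 0"
  proof (rule bounded_potential_has_no_log_pole[of "\<rho>/2" a "\<lambda>z. v z - Re (W z)" _ "M + B"])
    fix z assume z: "z \<in> ball a (\<rho>/2) - {a}"
    then have z': "z \<in> ball a \<rho> - {a}" "z \<in> cball a (\<rho>/2)" using \<rho> by auto
    show "((\<lambda>z. v z - Re (W z)) has_derivative (\<lambda>h. Re (g a / (z - a) * h))) (at z)"
      using dery[OF z'(1)] .
    show "\<bar>v z - Re (W z)\<bar> \<le> M + B"
      using bdd[OF z'(1)] B[OF z'(2)] abs_Re_le_cmod[of "W z"] by linarith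
  qed (use \<rho> in auto)
  have conn: "connected (ball a \<rho> - {a})"
    by (intro connected_open_delete) auto
  have const: "v x - Re (W x) = v y - Re (W y)" if "x \<in> ball a \<rho> - {a}" "y \<in> ball a \<rho> - {a}" for x y
    by (rule has_derivative_zero_unique_connected[of "ball a \<rho> - {a}"])
      (use that conn dery \<open>g a = 0\<close> in auto)
  have "a + complex_of_real (\<rho>/2) \<in> ball a \<rho> - {a}" using \<rho> by (auto simp: dist_norm)
  then obtain c where c: "\<And>z. z \<in> ball a \<rho> - {a} \<Longrightarrow> v z = Re (W z) + c"
    using const by (metis add_diff_cancel_left' diff_add_cancel diff_eq_eq add.commute)
  show ?thesis
    by (rule exI[of _ "\<lambda>z. W z + complex_of_real c"]) (use c holW in \<open>auto intro!: holomorphic_intros\<close>)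
qed

lemma Green_function_finite:
  assumes "is_Green_function \<Omega> a G" "z \<in> \<Omega> - {a}"
  shows "G z = ereal (real_of_ereal (G z))"
proof -
  have "\<forall>z\<in>\<Omega> - {a}. \<bar>G z\<bar> \<noteq> \<infinity> \<and> G z < 0"
    using assms(1) unfolding is_Green_function_def by (elim conjE)
  from bspec[OF this assms(2)] have "\<bar>G z\<bar> \<noteq> \<infinity>" by (rule conjunct1)
  then show ?thesis by (simp add: ereal_real')
qed

lemma Green_function_near_pole:
  assumes G: "is_Green_function \<Omega> a G" and "open \<Omega>" "a \<in> \<Omega>"
  obtains \<rho> W where "\<rho> > 0" "ball a \<rho> \<subseteq> \<Omega>" "W holomorphic_on ball a \<rho>"
    "\<And>z. z \<in> ball a \<rho> - {a} \<Longrightarrow> real_of_ereal (G z) = ln (cmod (z - a)) + Re (W z)"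
proof -
  let ?u = "\<lambda>z. real_of_ereal (G z)"
  obtain Q where Q: "Q holomorphic_on \<Omega> - {a}"
    "\<And>z. z \<in> \<Omega> - {a} \<Longrightarrow> (?u has_derivative (\<lambda>h. Re (Q z * h))) (at z)"
    using G \<open>open \<Omega>\<close> unfolding is_Green_function_def
    by (metis harmonic_on_imp_holomorphic_gradient open_delete)
  obtain M where "\<forall>\<^sub>F z in at a. \<bar>?u z - ln (cmod (z - a))\<bar> \<le> M"
    using G unfolding is_Green_function_def by blast
  then obtain e where e: "e > 0" "\<And>z. z \<noteq> a \<Longrightarrow> dist z a < e \<Longrightarrow> \<bar>?u z - ln (cmod (z - a))\<bar> \<le> M"
    unfolding eventually_at by blast
  obtain e' where e': "e' > 0" "ball a e' \<subseteq> \<Omega>"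
    using \<open>open \<Omega>\<close> \<open>a \<in> \<Omega>\<close> openE by blast
  define \<rho> where "\<rho> = min e e'"
  have \<rho>: "\<rho> > 0" "ball a \<rho> \<subseteq> \<Omega>" using e(1) e' by (auto simp: \<rho>_def)
  have "\<exists>W. W holomorphic_on ball a \<rho> \<and> (\<forall>z\<in>ball a \<rho> - {a}. ?u z - ln (cmod (z - a)) = Re (W z))"
  proof (rule bounded_harmonic_removable_singularity[OF \<rho>(1), of "\<lambda>z. Q z - 1 / (z - a)" a "\<lambda>z. ?u z - ln (cmod (z - a))" M])
    show "(\<lambda>z. Q z - 1 / (z - a)) holomorphic_on ball a \<rho> - {a}"
      using Q(1) \<rho>(2) by (auto intro!: holomorphic_intros elim: holomorphic_on_subset)
    fix z assume z: "z \<in> ball a \<rho> - {a}"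
    then have "z \<in> \<Omega> - {a}" "z \<noteq> a" using \<rho> by auto
    from has_derivative_diff[OF Q(2)[OF this(1)] has_derivative_ln_cmod[OF this(2)]]
    show "((\<lambda>z. ?u z - ln (cmod (z - a))) has_derivative (\<lambda>h. Re ((Q z - 1 / (z - a)) * h))) (at z)"
      by (simp add: algebra_simps)
    show "\<bar>?u z - ln (cmod (z - a))\<bar> \<le> M"
      using e(2)[of z] z by (auto simp: \<rho>_def dist_commute)
  qed
  then obtain W where W: "W holomorphic_on ball a \<rho>"
     "\<And>z. z \<in> ball a \<rho> - {a} \<Longrightarrow> ?u z - ln (cmod (z - a)) = Re (W z)"
    by blast
  show ?thesis
  proof (rule that[OF \<rho> W(1)])
    fix z assume "z \<in> ball a \<rho> - {a}"
    from W(2)[OF this] show "?u z = ln (cmod (z - a)) + Re (W z)" by linarith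
  qed
qed

text \<open>By the identity theorem the gradient of \<open>G\<close> is \<open>1 / (z - a)\<close> on all of \<open>\<Omega> - {a}\<close>, so the radial
  formula holds globally. Then \<open>G < 0\<close> puts \<open>\<Omega>\<close> inside the disc, and the boundary values of \<open>G\<close> put the
  frontier of \<open>\<Omega>\<close> on its circle.\<close>

lemma Green_function_radial_imp_disc:
  assumes G: "is_Green_function \<Omega> a G" and \<Omega>: "open \<Omega>" "connected \<Omega>" "a \<in> \<Omega>"
    and \<epsilon>: "\<epsilon> > 0" "ball a \<epsilon> \<subseteq> \<Omega>"
    and radial: "\<And>z. z \<in> ball a \<epsilon> - {a} \<Longrightarrow> real_of_ereal (G z) = ln (cmod (z - a)) + C"
  shows "\<Omega> = ball a (exp (- C))"
proof -
  let ?u = "\<lambda>z. real_of_ereal (G z)"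
  obtain Q where Q: "Q holomorphic_on \<Omega> - {a}"
    "\<And>z. z \<in> \<Omega> - {a} \<Longrightarrow> (?u has_derivative (\<lambda>h. Re (Q z * h))) (at z)"
    using G \<open>open \<Omega>\<close> unfolding is_Green_function_def
    by (metis harmonic_on_imp_holomorphic_gradient open_delete)
  have opO: "open (\<Omega> - {a})" "connected (\<Omega> - {a})"
    using \<Omega> by (auto intro: connected_open_delete)
  define v where "v = (\<lambda>z. ?u z - ln (cmod (z - a)))"
  have derv: "(v has_derivative (\<lambda>h. Re ((Q z - 1 / (z - a)) * h))) (at z)" if "z \<in> \<Omega> - {a}" for z
  proof -
    have "z \<noteq> a" using that by simp
    from has_derivative_diff[OF Q(2)[OF that] has_derivative_ln_cmod[OF this]]
    show ?thesis unfolding v_def by (simp add: algebra_simps)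
  qed
  define z1 where "z1 = a + complex_of_real (\<epsilon>/2)"
  have z1: "z1 \<in> ball a \<epsilon> - {a}" using \<epsilon> by (auto simp: z1_def dist_norm)
  have P0: "Q z - 1 / (z - a) = 0" if z: "z \<in> \<Omega> - {a}" for z
  proof (rule analytic_continuation_open[of "ball a \<epsilon> - {a}" "\<Omega> - {a}" "\<lambda>z. Q z - 1 / (z - a)" "\<lambda>_. 0"])
    show "ball a \<epsilon> - {a} \<noteq> {}" using z1 by blast
    show "(\<lambda>z. Q z - 1 / (z - a)) holomorphic_on \<Omega> - {a}"
      using Q(1) by (auto intro!: holomorphic_intros)
    fix w assume w: "w \<in> ball a \<epsilon> - {a}"
    then have "(v has_derivative (\<lambda>h. Re ((Q w - 1 / (w - a)) * h))) (at w)"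
      using \<epsilon> by (intro derv) auto
    moreover have "(v has_derivative (\<lambda>h. 0)) (at w)"
    proof (rule has_derivative_transform_within_open)
      show "((\<lambda>_. C) has_derivative (\<lambda>h. 0)) (at w)" by simp
      show "open (ball a \<epsilon> - {a})" by auto
      show "C = v x" if "x \<in> ball a \<epsilon> - {a}" for x
        using radial[OF that] by (simp add: v_def)
    qed (fact w)
    ultimately have *: "(\<lambda>h. Re ((Q w - 1 / (w - a)) * h)) = (\<lambda>h. 0)"
      by (rule has_derivative_unique)
    show "Q w - 1 / (w - a) = 0"
      using fun_cong[OF *, of 1] fun_cong[OF *, of \<i>] by (simp add: complex_eq_iff)
  qed (use opO \<epsilon> z in auto)
  have u_eq: "?u z = ln (cmod (z - a)) + C" if z: "z \<in> \<Omega> - {a}" for z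
  proof -
    have "v z = v z1"
      by (rule has_derivative_zero_unique_connected[OF opO]) (use derv P0 z z1 \<epsilon> in auto)
    also have "v z1 = C" using radial[OF z1] by (simp add: v_def)
    finally show ?thesis by (simp add: v_def)
  qed
  have G_eq: "G z = ereal (ln (cmod (z - a)) + C)" if z: "z \<in> \<Omega> - {a}" for z
    using Green_function_finite[OF G z] u_eq[OF z] by simp
  have sub: "\<Omega> \<subseteq> ball a (exp (- C))"
  proof
    fix z assume z: "z \<in> \<Omega>"
    show "z \<in> ball a (exp (- C))"
    proof (cases "z = a")
      case False
      then have "G z < 0" using G z unfolding is_Green_function_def by blast
      then have "ln (cmod (z - a)) < - C" using G_eq[of z] z False by (simp flip: zero_ereal_def)
      then have "cmod (z - a) < exp (- C)" using False
        by (metis exp_less_mono exp_ln right_minus_eq zero_less_norm_iff)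
      then show ?thesis by (simp add: dist_norm norm_minus_commute)
    qed simp
  qed
  have fr: "cmod (\<zeta> - a) = exp (- C)" if \<zeta>: "\<zeta> \<in> frontier \<Omega>" for \<zeta>
  proof -
    have ne: "\<zeta> \<noteq> a" and nin: "\<zeta> \<notin> \<Omega>"
      using \<zeta> \<Omega> by (auto simp: frontier_def interior_open)
    have lim0: "(G \<longlongrightarrow> 0) (at \<zeta> within \<Omega>)"
      using G \<zeta> unfolding is_Green_function_def by blast
    have nontriv: "at \<zeta> within \<Omega> \<noteq> bot"
      using \<zeta> nin by (auto simp: frontier_def trivial_limit_within closure_def)
    have "((\<lambda>z. ereal (ln (cmod (z - a)) + C)) \<longlongrightarrow> ereal (ln (cmod (\<zeta> - a)) + C)) (at \<zeta> within \<Omega>)"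
      using ne by (intro tendsto_intros) auto
    moreover have "\<forall>\<^sub>F z in at \<zeta> within \<Omega>. z \<in> \<Omega> - {a}"
      using ne nin by (auto simp: eventually_at dist_commute intro!: exI[of _ "dist \<zeta> a"])
    then have "\<forall>\<^sub>F z in at \<zeta> within \<Omega>. ereal (ln (cmod (z - a)) + C) = G z"
      by eventually_elim (use G_eq in auto)
    ultimately have "(G \<longlongrightarrow> ereal (ln (cmod (\<zeta> - a)) + C)) (at \<zeta> within \<Omega>)"
      by (rule Lim_transform_eventually)
    then have "ereal (ln (cmod (\<zeta> - a)) + C) = 0"
      using lim0 nontriv tendsto_unique by blast
    then have "ln (cmod (\<zeta> - a)) = - C" by (simp flip: zero_ereal_def)
    then show ?thesis using ne by (metis exp_ln right_minus_eq zero_less_norm_iff)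
  qed
  have "ball a (exp (- C)) - \<Omega> = {}"
  proof (rule ccontr)
    assume "ball a (exp (- C)) - \<Omega> \<noteq> {}"
    moreover have "a \<in> ball a (exp (- C)) \<inter> \<Omega>" using \<Omega> by simp
    then have "ball a (exp (- C)) \<inter> \<Omega> \<noteq> {}" by blast
    ultimately have "ball a (exp (- C)) \<inter> frontier \<Omega> \<noteq> {}"
      by (intro connected_Int_frontier) auto
    then show False using fr by (auto simp: dist_norm norm_minus_commute)
  qed
  with sub show ?thesis by blast
qed

section \<open>The multiplier ideal of the Green function\<close>

lemma holomorphic_factor_power_or_lower_order:
  assumes "open S" "a \<in> S" "g holomorphic_on S"
  shows "(\<exists>h. h holomorphic_on S \<and> (\<forall>z\<in>S. g z = (z - a) ^ n * h z)) \<or>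
    (\<exists>j<n. \<exists>h. h holomorphic_on S \<and> h a \<noteq> 0 \<and> (\<forall>z\<in>S. g z = (z - a) ^ j * h z))"
proof (induction n)
  case 0
  show ?case using assms by auto
next
  case (Suc n)
  then show ?case
  proof (elim disjE)
    assume "\<exists>j<n. \<exists>h. h holomorphic_on S \<and> h a \<noteq> 0 \<and> (\<forall>z\<in>S. g z = (z - a) ^ j * h z)"
    then show ?case using less_SucI by blast
  next
    assume "\<exists>h. h holomorphic_on S \<and> (\<forall>z\<in>S. g z = (z - a) ^ n * h z)"
    then obtain h where h: "h holomorphic_on S" "\<And>z. z \<in> S \<Longrightarrow> g z = (z - a) ^ n * h z" by blast
    show ?case
    proof (cases "h a = 0")
      case False
      then show ?thesis using h by blast
    next
      case True
      define q where "q = (\<lambda>z. if z = a then deriv h a else (h z - h a) / (z - a))"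
      have "q holomorphic_on S" unfolding q_def by (rule pole_lemma_open[OF h(1) assms(1)])
      moreover have "g z = (z - a) ^ Suc n * q z" if "z \<in> S" for z
        using h(2)[OF that] True by (simp add: q_def)
      ultimately show ?thesis by blast
    qed
  qed
qed

text \<open>The integral is invariant under scaling by \<open>1 / 2\<close> about \<open>a\<close>. If it were finite, the annulus between
  the radii \<open>\<epsilon> / 2\<close> and \<open>\<epsilon>\<close> would contribute nothing; but it contains a disc on which the integrand is
  at least \<open>1 / \<epsilon>\<^sup>2\<close>.\<close>

lemma nn_integral_inverse_square_ball:
  fixes a :: complex
  assumes \<epsilon>: "\<epsilon> > 0"
  shows "(\<integral>\<^sup>+z\<in>ball a \<epsilon>. ennreal (1 / (cmod (z - a))\<^sup>2) \<partial>lborel) = \<infinity>"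
proof (rule ccontr)
  let ?u = "\<lambda>z. 1 / (cmod (z - a))\<^sup>2"
  let ?I = "\<lambda>S. (\<integral>\<^sup>+z\<in>S. ennreal (?u z) \<partial>lborel)"
  assume fin: "?I (ball a \<epsilon>) \<noteq> \<infinity>"
  define g where "g = (\<lambda>w. a + (w - a) / 2)"
  have dg: "deriv g w = 1 / 2" for w
    unfolding g_def by (intro DERIV_imp_deriv) (auto intro!: derivative_eq_intros)
  have img: "g ` ball a \<epsilon> = ball a (\<epsilon> / 2)"
  proof (intro subset_antisym subsetI)
    fix z assume "z \<in> ball a (\<epsilon>/2)"
    then have "cmod (2 * (z - a)) < \<epsilon>"
      unfolding norm_mult by (simp add: dist_norm norm_minus_commute)
    moreover have "dist a (a + 2 * (z - a)) = cmod (2 * (z - a))"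
      by (metis add_diff_cancel_left' dist_commute dist_norm)
    ultimately have "a + 2 * (z - a) \<in> ball a \<epsilon>" by simp
    moreover have "z = g (a + 2 * (z - a))"
      by (simp add: g_def diff_divide_distrib right_diff_distrib)
    ultimately show "z \<in> g ` ball a \<epsilon>" by blast
  qed (auto simp: g_def dist_norm norm_divide norm_minus_commute)
  have "?I (ball a (\<epsilon>/2)) = (\<integral>\<^sup>+w\<in>ball a \<epsilon>. ennreal ((cmod (deriv g w))\<^sup>2 * ?u (g w)) \<partial>lborel)"
    unfolding img[symmetric]
    by (rule nn_integral_holomorphic_change_of_variables)
       (auto simp: g_def inj_on_def intro!: holomorphic_intros)
  also have "\<dots> = ?I (ball a \<epsilon>)"
  proof -
    have "(cmod (deriv g w))\<^sup>2 * ?u (g w) = ?u w" for w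
    proof -
      have "g w - a = (w - a) / 2" by (simp add: g_def)
      then show ?thesis unfolding dg by (simp only: norm_divide) (simp add: power_divide)
    qed
    then show ?thesis by (simp only:)
  qed
  finally have eq: "?I (ball a (\<epsilon>/2)) = ?I (ball a \<epsilon>)" .
  define c where "c = complex_of_real (3/4 * \<epsilon>)"
  let ?B = "ball (a + c) (\<epsilon> / 4)"
  have B: "cmod (z - a) < \<epsilon> \<and> \<epsilon> / 2 < cmod (z - a)" if "z \<in> ?B" for z
  proof -
    have "cmod (z - (a + c)) < \<epsilon> / 4" using that by (simp add: dist_norm norm_minus_commute)
    moreover have "cmod c = 3/4 * \<epsilon>" unfolding c_def norm_of_real using \<epsilon> by simp
    moreover have "cmod (z - a) \<le> cmod (z - (a + c)) + cmod c"
      using norm_triangle_ineq[of "z - (a + c)" c] by simp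
    moreover have "cmod c \<le> cmod (z - a) + cmod (z - (a + c))"
      using norm_triangle_ineq4[of "z - a" "z - (a + c)"] by simp
    ultimately show ?thesis by linarith
  qed
  have "?I (ball a (\<epsilon>/2)) + ennreal (1 / \<epsilon>\<^sup>2) * emeasure lborel ?B
     = (\<integral>\<^sup>+z. ennreal (?u z) * indicator (ball a (\<epsilon>/2)) z + ennreal (1 / \<epsilon>\<^sup>2) * indicator ?B z \<partial>lborel)"
  proof -
    have [measurable]: "ball a (\<epsilon>/2) \<in> sets borel" "?B \<in> sets borel" by simp_all
    have "(\<lambda>z. ennreal (?u z) * indicator (ball a (\<epsilon>/2)) z) \<in> borel_measurable lborel"
      "(\<lambda>z. ennreal (1 / \<epsilon>\<^sup>2) * indicator ?B z) \<in> borel_measurable lborel"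
      by measurable
    from nn_integral_add[OF this] show ?thesis by (simp add: nn_integral_cmult_indicator)
  qed
  also have "\<dots> \<le> ?I (ball a \<epsilon>)"
  proof (rule nn_integral_mono)
    fix z :: complex
    show "ennreal (?u z) * indicator (ball a (\<epsilon>/2)) z + ennreal (1 / \<epsilon>\<^sup>2) * indicator ?B z
        \<le> ennreal (?u z) * indicator (ball a \<epsilon>) z"
    proof (cases "z \<in> ?B")
      case True
      note * = B[OF this]
      have "1 / \<epsilon>\<^sup>2 \<le> ?u z" using * \<epsilon> by (intro divide_left_mono power_mono mult_pos_pos zero_less_power) auto
      then show ?thesis using * True by (auto simp: indicator_def dist_norm norm_minus_commute ennreal_leI)
    next
      case False
      then show ?thesis using \<epsilon> by (auto simp: indicator_def)
    qed
  qed
  finally have le: "?I (ball a \<epsilon>) + ennreal (1 / \<epsilon>\<^sup>2) * emeasure lborel ?B \<le> ?I (ball a \<epsilon>)"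
    unfolding eq .
  have em: "emeasure lborel ?B = ennreal (pi * (\<epsilon>/4)\<^sup>2)"
    using \<epsilon> by (simp add: emeasure_ball unit_ball_vol_2)
  have "?I (ball a \<epsilon>) + ennreal (1 / \<epsilon>\<^sup>2 * (pi * (\<epsilon>/4)\<^sup>2)) \<le> ?I (ball a \<epsilon>)"
    using le unfolding em by (subst ennreal_mult) auto
  moreover obtain x where x: "x \<ge> 0" "?I (ball a \<epsilon>) = ennreal x"
    using fin by (cases "?I (ball a \<epsilon>)" rule: ennreal_cases) auto
  ultimately have "ennreal (x + 1 / \<epsilon>\<^sup>2 * (pi * (\<epsilon>/4)\<^sup>2)) \<le> ennreal x"
    by (subst ennreal_plus) auto
  then have "x + 1 / \<epsilon>\<^sup>2 * (pi * (\<epsilon>/4)\<^sup>2) \<le> x" using x by (subst (asm) ennreal_le_iff)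
  moreover have "1 / \<epsilon>\<^sup>2 * (pi * (\<epsilon>/4)\<^sup>2) > 0" using \<epsilon> by simp
  ultimately show False by linarith
qed

text \<open>Near \<open>a\<close> the weight \<open>exp (- 2 n G)\<close> is comparable to \<open>|z - a|\<^bsup>-2n\<^esup>\<close>. If \<open>g\<close> vanished to an order
  \<open>j < n\<close> only, the integrand would be at least a multiple of \<open>|z - a|\<^bsup>-2\<^esup>\<close>.\<close>

lemma multiplier_ideal_Green_imp_vanishing:
  assumes G: "is_Green_function \<Omega> a G" and "open \<Omega>" "a \<in> \<Omega>"
    and S: "open S" "a \<in> S" "g holomorphic_on S"
    and mem: "g \<in> multiplier_ideal_stalk (\<lambda>z. ereal (2 * real n) * G z) a"
  obtains h where "h holomorphic_on S" "\<And>z. z \<in> S \<Longrightarrow> g z = (z - a) ^ n * h z"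
proof -
  have "\<not> (\<exists>j<n. \<exists>h. h holomorphic_on S \<and> h a \<noteq> 0 \<and> (\<forall>z\<in>S. g z = (z - a) ^ j * h z))"
  proof (intro notI, elim exE conjE)
    fix j h assume j: "j < n" and h: "h holomorphic_on S" "h a \<noteq> 0" "\<forall>z\<in>S. g z = (z - a) ^ j * h z"
    obtain U where U: "open U" "a \<in> U"
      and fin: "(\<integral>\<^sup>+w\<in>U. ennreal ((cmod (g w))\<^sup>2) * exp_minus (ereal (2 * real n) * G w) \<partial>lborel) < \<infinity>"
      using mem unfolding multiplier_ideal_stalk_def by blast
    obtain M where "\<forall>\<^sub>F z in at a. \<bar>real_of_ereal (G z) - ln (cmod (z - a))\<bar> \<le> M"
      using G unfolding is_Green_function_def by blast
    then obtain e1 where e1: "e1 > 0" "\<And>z. z \<noteq> a \<Longrightarrow> dist z a < e1 \<Longrightarrow> \<bar>real_of_ereal (G z) - ln (cmod (z - a))\<bar> \<le> M"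
      unfolding eventually_at by blast
    obtain e2 where e2: "e2 > 0" "ball a e2 \<subseteq> U \<inter> S \<inter> \<Omega>"
      using U S \<open>open \<Omega>\<close> \<open>a \<in> \<Omega>\<close> openE[of "U \<inter> S \<inter> \<Omega>" a] by auto
    have "continuous (at a) h"
      using h(1) S(1,2)
      by (meson field_differentiable_imp_continuous_at holomorphic_on_imp_differentiable_at)
    then obtain e3 where e3: "e3 > 0" "\<And>z. dist z a < e3 \<Longrightarrow> dist (h z) (h a) < cmod (h a) / 2"
      using h(2) unfolding continuous_at_eps_delta by (metis half_gt_zero zero_less_norm_iff)
    define \<epsilon> where "\<epsilon> = Min {e1, e2, e3, 1}"
    have \<epsilon>: "\<epsilon> > 0" "\<epsilon> \<le> e1" "\<epsilon> \<le> e2" "\<epsilon> \<le> e3" "\<epsilon> \<le> 1"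
      using e1 e2 e3 by (auto simp: \<epsilon>_def)
    \<comment> \<open>The factors bound \<open>|h|\<^sup>2\<close> and \<open>exp (- 2 n (G - ln |z - a|))\<close> from below on \<open>ball a \<epsilon>\<close>.\<close>
    define c where "c = (cmod (h a) / 2)\<^sup>2 * exp (- (2 * real n * M))"
    have c: "c > 0" using h(2) by (simp add: c_def)
    have pw: "ennreal c * (ennreal (1 / (cmod (z - a))\<^sup>2) * indicator (ball a \<epsilon>) z)
      \<le> ennreal ((cmod (g z))\<^sup>2) * exp_minus (ereal (2 * real n) * G z) * indicator U z" for z
    proof (cases "z \<in> ball a \<epsilon> - {a}")
      case True
      then have z: "z \<noteq> a" "dist z a < \<epsilon>" "z \<in> U" "z \<in> S" "z \<in> \<Omega>"
        using e2 \<epsilon> by (auto simp: dist_commute subset_iff)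
      define x where "x = cmod (z - a)"
      have x: "0 < x" "x \<le> 1" using z \<epsilon> by (auto simp: x_def dist_norm)
      have "G z = ereal (real_of_ereal (G z))" using Green_function_finite[OF G] z by blast
      then have em: "exp_minus (ereal (2 * real n) * G z) = ennreal (exp (- (2 * real n * real_of_ereal (G z))))"
        by (metis exp_minus_def ereal.distinct(1,3,5) MInfty_neq_ereal(1) PInfty_neq_ereal(1) real_of_ereal.simps(1) times_ereal.simps(1))
      have "real_of_ereal (G z) \<le> ln x + M"
        using e1(2)[OF z(1)] z(2) \<epsilon> by (auto simp: x_def abs_le_iff)
      then have "2 * real n * real_of_ereal (G z) \<le> 2 * real n * (ln x + M)"
        by (intro mult_left_mono) auto
      then have "exp (- (2 * real n * M)) * exp (- (2 * real n * ln x)) \<le> exp (- (2 * real n * real_of_ereal (G z)))"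
        unfolding exp_add[symmetric] by (simp add: algebra_simps)
      moreover have "exp (- (2 * real n * ln x)) = 1 / x ^ (2 * n)"
        using x exp_of_nat_mult[of "2 * n" "ln x"] by (simp add: exp_minus field_simps)
      ultimately have 1: "exp (- (2 * real n * M)) * (1 / x ^ (2 * n)) \<le> exp (- (2 * real n * real_of_ereal (G z)))"
        by simp
      have "cmod (h a) / 2 \<le> cmod (h z)"
        using e3(2)[of z] z \<epsilon> norm_triangle_ineq2[of "h a" "h z"] by (simp add: dist_norm norm_minus_commute)
      then have "x ^ (2 * j) * (cmod (h a) / 2)\<^sup>2 \<le> x ^ (2 * j) * (cmod (h z))\<^sup>2"
        using x by (intro mult_left_mono power_mono) auto
      also have "\<dots> = (cmod (g z))\<^sup>2"
        using h(3) z by (simp add: norm_mult norm_power x_def power_mult_distrib power_mult[symmetric] mult.commute)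
      finally have 2: "x ^ (2 * j) * (cmod (h a) / 2)\<^sup>2 \<le> (cmod (g z))\<^sup>2" .
      have "x ^ (2 * n) \<le> x ^ (2 * j + 2)" using x j by (intro power_decreasing) auto
      then have 3: "1 / x\<^sup>2 \<le> x ^ (2 * j) * (1 / x ^ (2 * n))"
      proof -
        have "1 / Y \<le> Z * (1 / X)" if "X \<le> Z * Y" "X > 0" "Y > 0" for X Y Z :: real
          using that by (simp add: field_simps)
        moreover have "x ^ (2 * n) \<le> x ^ (2 * j) * x\<^sup>2"
          using \<open>x ^ (2 * n) \<le> x ^ (2 * j + 2)\<close> unfolding power_add .
        ultimately show ?thesis using x by simp
      qed
      have "c * (1 / x\<^sup>2) \<le> c * (x ^ (2 * j) * (1 / x ^ (2 * n)))"
        using 3 c by (intro mult_left_mono) auto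
      also have "\<dots> = (x ^ (2 * j) * (cmod (h a) / 2)\<^sup>2) * (exp (- (2 * real n * M)) * (1 / x ^ (2 * n)))"
        by (simp add: c_def)
      also have "\<dots> \<le> (cmod (g z))\<^sup>2 * exp (- (2 * real n * real_of_ereal (G z)))"
        using 1 2 x by (intro mult_mono) auto
      finally have "ennreal (c * (1 / x\<^sup>2)) \<le> ennreal ((cmod (g z))\<^sup>2 * exp (- (2 * real n * real_of_ereal (G z))))"
        by (rule ennreal_leI)
      moreover have "ennreal c * (ennreal (1 / (cmod (z - a))\<^sup>2) * indicator (ball a \<epsilon>) z) = ennreal (c * (1 / x\<^sup>2))"
        using True c by (subst ennreal_mult) (auto simp: x_def)
      moreover have "ennreal ((cmod (g z))\<^sup>2) * exp_minus (ereal (2 * real n) * G z) * indicator U z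
          = ennreal ((cmod (g z))\<^sup>2 * exp (- (2 * real n * real_of_ereal (G z))))"
        using z unfolding em by (subst ennreal_mult) auto
      ultimately show ?thesis by simp
    qed (auto simp: indicator_def)
    have "\<infinity> = ennreal c * (\<integral>\<^sup>+z\<in>ball a \<epsilon>. ennreal (1 / (cmod (z - a))\<^sup>2) \<partial>lborel)"
      using c by (simp add: nn_integral_inverse_square_ball[OF \<epsilon>(1)] ennreal_mult_top)
    also have "\<dots> = (\<integral>\<^sup>+z. ennreal c * (ennreal (1 / (cmod (z - a))\<^sup>2) * indicator (ball a \<epsilon>) z) \<partial>lborel)"
    proof -
      have [measurable]: "ball a \<epsilon> \<in> sets borel" by simp
      have "(\<lambda>z. ennreal (1 / (cmod (z - a))\<^sup>2) * indicator (ball a \<epsilon>) z) \<in> borel_measurable lborel"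
        by measurable
      from nn_integral_cmult[OF this] show ?thesis by simp
    qed
    also have "\<dots> \<le> (\<integral>\<^sup>+w\<in>U. ennreal ((cmod (g w))\<^sup>2) * exp_minus (ereal (2 * real n) * G w) \<partial>lborel)"
      by (intro nn_integral_mono pw)
    finally show False using fin by simp
  qed
  then show ?thesis
    using holomorphic_factor_power_or_lower_order[OF S, of n] that by blast
qed

section \<open>The conformal coordinate given by the Green function\<close>

text \<open>\<open>f\<close> inverts \<open>g z = (z - a) exp (W z)\<close>, for which \<open>G = ln |g|\<close> near \<open>a\<close>. The radius \<open>R\<close> is chosen
  so small that \<open>exp (- s) \<le> R\<close> forces the sublevel set \<open>{G < -s}\<close> into the range of \<open>f\<close>; this is possible
  because \<open>G\<close> is bounded away from the pole.\<close>

lemma Green_function_conformal_coordinate: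
  assumes G: "is_Green_function \<Omega> a G" and \<Omega>: "open \<Omega>" "a \<in> \<Omega>"
  obtains f R where "R > 0" "f holomorphic_on ball 0 R" "inj_on f (ball 0 R)" "f 0 = a"
    "f ` ball 0 R \<subseteq> \<Omega>"
    "\<And>w. w \<in> ball 0 R - {0} \<Longrightarrow> real_of_ereal (G (f w)) = ln (cmod w)"
    "\<And>s. exp (- s) \<le> R \<Longrightarrow> {z\<in>\<Omega>. G z < ereal (- s)} = f ` ball 0 (exp (- s))"
proof -
  obtain \<rho> W where \<rho>: "\<rho> > 0" "ball a \<rho> \<subseteq> \<Omega>" and W: "W holomorphic_on ball a \<rho>"
    and u: "\<And>z. z \<in> ball a \<rho> - {a} \<Longrightarrow> real_of_ereal (G z) = ln (cmod (z - a)) + Re (W z)"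
    using Green_function_near_pole[OF G \<Omega>] by metis
  define g where "g = (\<lambda>z. (z - a) * exp (W z))"
  have holg: "g holomorphic_on ball a \<rho>"
    unfolding g_def using W by (intro holomorphic_intros)
  have "W field_differentiable at a"
    using W \<rho> by (meson centre_in_ball holomorphic_on_imp_differentiable_at open_ball)
  then obtain W' where "(W has_field_derivative W') (at a)" unfolding field_differentiable_def by blast
  then have "(g has_field_derivative exp (W a)) (at a)"
    unfolding g_def by (auto intro!: derivative_eq_intros)
  then have "deriv g a \<noteq> 0" by (simp add: DERIV_imp_deriv)
  then obtain r where r: "r > 0" "ball a r \<subseteq> ball a \<rho>" "open (g ` ball a r)" "inj_on g (ball a r)"
    using has_complex_derivative_locally_invertible[OF holg, of a] \<rho> by auto
  have "g holomorphic_on ball a r" using holg r(2) by (rule holomorphic_on_subset)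
  then obtain f where f: "f holomorphic_on g ` ball a r" "\<And>z. z \<in> ball a r \<Longrightarrow> f (g z) = z"
    using holomorphic_has_inverse[OF _ open_ball r(4)] by metis
  have "0 \<in> g ` ball a r" using r(1) by (auto simp: g_def intro!: image_eqI[of _ _ a])
  then obtain R0 where R0: "R0 > 0" "ball 0 R0 \<subseteq> g ` ball a r"
    using r(3) openE by blast
  have gf: "g (f w) = w \<and> f w \<in> ball a r" if w: "w \<in> ball 0 R0" for w
  proof -
    obtain z where "z \<in> ball a r" "w = g z" using w R0(2) by blast
    then show ?thesis using f(2) by simp
  qed
  have f0: "f 0 = a" using f(2)[of a] r(1) by (simp add: g_def)
  have injf: "inj_on f (ball 0 R0)" using gf by (metis inj_onI)
  have holf: "f holomorphic_on ball 0 R0" using f(1) R0(2) by (rule holomorphic_on_subset)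
  have Gf: "real_of_ereal (G (f w)) = ln (cmod w)" if w: "w \<in> ball 0 R0 - {0}" for w
  proof -
    have w': "w \<in> ball 0 R0" "w \<noteq> 0" using w by auto
    have "f w \<noteq> a" using gf[OF w'(1)] w'(2) by (auto simp: g_def)
    then have "f w \<in> ball a \<rho> - {a}" using gf[OF w'(1)] r(2) by blast
    from u[OF this] have "real_of_ereal (G (f w)) = ln (cmod (f w - a) * exp (Re (W (f w))))"
      using \<open>f w \<noteq> a\<close> by (simp add: ln_mult)
    also have "cmod (f w - a) * exp (Re (W (f w))) = cmod (g (f w))"
      by (simp add: g_def norm_mult)
    finally show ?thesis using gf[OF w'(1)] by simp
  qed
  have "open (f ` ball 0 R0)" by (rule open_mapping_thm3[OF holf open_ball injf])
  moreover have "a \<in> f ` ball 0 R0" using f0 R0(1) by force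
  ultimately obtain \<delta> where \<delta>: "\<delta> > 0" "ball a \<delta> \<subseteq> f ` ball 0 R0" using openE by blast
  have "bounded ((\<lambda>z. real_of_ereal (G z)) ` (\<Omega> - ball a \<delta>))"
    using G \<delta>(1) unfolding is_Green_function_def by blast
  then obtain M where "\<forall>x\<in>(\<lambda>z. real_of_ereal (G z)) ` (\<Omega> - ball a \<delta>). norm x \<le> M"
    unfolding bounded_iff by blast
  then have M: "\<bar>real_of_ereal (G z)\<bar> \<le> M" if "z \<in> \<Omega> - ball a \<delta>" for z
  proof -
    have "real_of_ereal (G z) \<in> (\<lambda>z. real_of_ereal (G z)) ` (\<Omega> - ball a \<delta>)"
      using that by (rule imageI)
    from bspec[OF \<open>\<forall>x\<in>_. norm x \<le> M\<close> this] show ?thesis by simp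
  qed
  define R where "R = min R0 (exp (- M))"
  have R: "R > 0" "R \<le> R0" "R \<le> exp (- M)" using R0(1) by (auto simp: R_def)
  have sub: "ball 0 R \<subseteq> ball (0::complex) R0" using R by auto
  have fO: "f ` ball 0 R0 \<subseteq> \<Omega>" using gf r(2) \<rho>(2) by blast
  have fin: "G z = ereal (real_of_ereal (G z))" if "z \<in> \<Omega>" "z \<noteq> a" for z
    using Green_function_finite[OF G] that by blast
  have Ga: "G a = - \<infinity>" using G unfolding is_Green_function_def by blast
  show ?thesis
  proof (rule that[of R f])
    show "f holomorphic_on ball 0 R" "inj_on f (ball 0 R)" "f ` ball 0 R \<subseteq> \<Omega>"
      using holf injf sub fO by (auto elim: holomorphic_on_subset inj_on_subset)
    show "real_of_ereal (G (f w)) = ln (cmod w)" if "w \<in> ball 0 R - {0}" for w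
      using that sub by (intro Gf) auto
    show "{z\<in>\<Omega>. G z < ereal (- s)} = f ` ball 0 (exp (- s))" if s: "exp (- s) \<le> R" for s
    proof (intro subset_antisym subsetI)
      fix z assume z: "z \<in> {z\<in>\<Omega>. G z < ereal (- s)}"
      show "z \<in> f ` ball 0 (exp (- s))"
      proof (cases "z = a")
        case True
        then show ?thesis using f0 by (intro image_eqI[of _ _ 0]) auto
      next
        case False
        have lt: "real_of_ereal (G z) < - s"
          using z fin[of z] False by (metis (no_types, lifting) ereal_less(2) less_ereal.simps(1) mem_Collect_eq)
        have "- s \<le> - M" using s R by (meson exp_le_cancel_iff order_trans)
        then have "\<not> \<bar>real_of_ereal (G z)\<bar> \<le> M" using lt by linarith
        then have "z \<in> ball a \<delta>" using M z by blast
        then obtain w where w: "w \<in> ball 0 R0" "z = f w" using \<delta>(2) by blast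
        then have "w \<noteq> 0" using f0 False by auto
        then have "ln (cmod w) < - s" using Gf[of w] lt w by simp
        then have "cmod w < exp (- s)" using \<open>w \<noteq> 0\<close>
          by (metis exp_less_mono exp_ln zero_less_norm_iff)
        then show ?thesis using w by auto
      qed
    next
      fix z assume "z \<in> f ` ball 0 (exp (- s))"
      then obtain w where w: "cmod w < exp (- s)" "z = f w" by auto
      then have w0: "w \<in> ball 0 R0" using s R by auto
      show "z \<in> {z\<in>\<Omega>. G z < ereal (- s)}"
      proof (cases "w = 0")
        case True
        then show ?thesis using w f0 Ga \<Omega> by simp
      next
        case False
        then have "f w \<noteq> a" using injf w0 f0 R0(1) by (metis centre_in_ball inj_onD)
        have "ln (cmod w) < - s" using w False by (metis exp_gt_zero ln_exp ln_less_cancel_iff zero_less_norm_iff)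
        then have "G (f w) < ereal (- s)" using fin[of "f w"] \<open>f w \<noteq> a\<close> Gf[of w] w0 False fO
          by (metis Diff_iff image_subset_iff less_ereal.simps(1) singletonD)
        then show ?thesis using w w0 fO by auto
      qed
    qed
  qed (use R f0 in auto)
qed

section \<open>Failure of convexity\<close>

text \<open>Put \<open>K t = H t * exp (c * t)\<close>; the factor \<open>exp (c * t)\<close> drops out of midpoint convexity, which
  becomes \<open>K t\<^sub>1 * K t\<^sub>3 \<le> (K t\<^sub>2)\<^sup>2\<close> for \<open>t\<^sub>2\<close> the midpoint of \<open>t\<^sub>1\<close> and \<open>t\<^sub>3\<close>. Take \<open>t\<^sub>1 = T\<close> and
  \<open>t\<^sub>2\<close> so large that \<open>(K t\<^sub>2)\<^sup>2 < A * K T\<close>, which is possible since \<open>A < K T\<close>. As \<open>A < K t\<^sub>3\<close>, this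
  contradicts the inequality.\<close>

lemma not_convex_neg_ln_of_exponential_asymptotics:
  fixes H :: "real \<Rightarrow> real"
  assumes A: "A > 0" and T: "T \<ge> 0"
    and low: "\<And>t. t \<ge> T \<Longrightarrow> H t > A * exp (- c * t)"
    and up: "\<And>A'. A' > A \<Longrightarrow> \<exists>t\<ge>T. H t \<le> A' * exp (- c * t)"
  shows "\<not> convex_on {0..} (\<lambda>t. - ln (H t))"
proof
  assume conv: "convex_on {0..} (\<lambda>t. - ln (H t))"
  define K where "K = (\<lambda>t. H t * exp (c * t))"
  have H_eq: "H t = K t * exp (- c * t)" for t by (simp add: K_def flip: exp_add)
  have lowK: "K t > A" if "t \<ge> T" for t
    using low[OF that] unfolding H_eq by simp
  have A_lt: "A < sqrt (A * K T)"
    using lowK[of T] A by (intro real_less_rsqrt) (simp add: power2_eq_square)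
  then obtain A' where A': "A < A'" "A' < sqrt (A * K T)" using dense by blast
  obtain t where t: "t \<ge> T" "H t \<le> A' * exp (- c * t)" using up[OF A'(1)] by blast
  have Kt: "K t \<le> A'" using t(2) unfolding H_eq by simp
  define t3 where "t3 = 2 * t - T"
  have t3: "t3 \<ge> T" using t by (simp add: t3_def)
  have pos: "H T > 0" "H t > 0" "H t3 > 0"
    using low[of T] low[of t] low[of t3] t t3 A by (auto intro: less_trans[rotated] mult_pos_pos)
  have mid: "(1 - 1/2) *\<^sub>R T + (1/2) *\<^sub>R t3 = t" by (simp add: t3_def field_simps)
  have "- ln (H t) \<le> (1 - 1/2) * (- ln (H T)) + 1/2 * (- ln (H t3))"
    using convex_onD[OF conv, of "1/2" T t3] T t3 unfolding mid by simp
  then have "ln (H T * H t3) \<le> ln (H t * H t)" using pos by (simp add: ln_mult)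
  then have "H T * H t3 \<le> H t * H t" using pos by simp
  moreover have "H T * H t3 = K T * K t3 * exp (- c * (2 * t))"
    unfolding H_eq t3_def by (simp add: algebra_simps flip: exp_add)
  moreover have "H t * H t = K t * K t * exp (- c * (2 * t))"
    unfolding H_eq by (simp add: algebra_simps flip: exp_add)
  ultimately have 1: "K T * K t3 \<le> K t * K t" by simp
  have "K t * K t \<le> A' * A'" using Kt lowK[OF t(1)] A by (intro mult_mono) auto
  also have "\<dots> < sqrt (A * K T) * sqrt (A * K T)"
  proof -
    have "0 < sqrt (A * K T)" using A' A by linarith
    then show ?thesis using A' A by (intro mult_strict_mono) auto
  qed
  also have "\<dots> = A * K T" using A lowK[of T] by simp
  also have "\<dots> \<le> K T * K t3" using lowK[of T] lowK[OF t3] A by simp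
  finally show False using 1 by simp
qed

section \<open>Bounds for the minimal integral\<close>

lemma sublevel_scaled_Green_function:
  assumes "is_Green_function \<Omega> a G" "c > 0"
  shows "sublevel \<Omega> (\<lambda>z. ereal c * G z) t = {z\<in>\<Omega>. G z < ereal (- (t / c))}"
proof -
  have "ereal c * G z < ereal (- t) \<longleftrightarrow> G z < ereal (- (t / c))" for z
    using assms(2) by (cases "G z") (auto simp: field_simps)
  then show ?thesis by (simp add: sublevel_def)
qed

text \<open>The constant function \<open>1\<close> is a competitor for every weight.\<close>

lemma minimal_L2_integral_le_area:
  assumes "sublevel \<Omega> \<Phi> t = f ` ball 0 r"
    and f: "f holomorphic_on ball 0 r" "inj_on f (ball 0 r)" and r: "0 < r"
    and B: "\<And>w. w \<in> ball 0 r \<Longrightarrow> (cmod (deriv f w))\<^sup>2 \<le> B"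
  shows "minimal_L2_integral \<Omega> z\<^sub>0 \<Phi> t \<le> ennreal (B * (pi * r\<^sup>2))"
proof -
  have "0 \<le> B" using B[of 0] r by (auto intro: order_trans[rotated])
  have "(\<lambda>z. 1 - 1) \<in> multiplier_ideal_stalk \<Phi> z\<^sub>0"
    unfolding multiplier_ideal_stalk_def by (auto intro!: exI[of _ UNIV])
  then have "minimal_L2_integral \<Omega> z\<^sub>0 \<Phi> t \<le> (\<integral>\<^sup>+z\<in>f ` ball 0 r. ennreal ((cmod 1)\<^sup>2) \<partial>lborel)"
    unfolding minimal_L2_integral_def assms(1)[symmetric]
    by (intro INF_lower) auto
  also have "\<dots> = (\<integral>\<^sup>+w\<in>ball 0 r. ennreal ((cmod (deriv f w))\<^sup>2 * (cmod 1)\<^sup>2) \<partial>lborel)"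
    by (rule nn_integral_holomorphic_change_of_variables) (use f in auto)
  also have "\<dots> \<le> (\<integral>\<^sup>+w. ennreal B * indicator (ball 0 r) (w::complex) \<partial>lborel)"
    using B by (intro nn_integral_mono) (auto simp: indicator_def ennreal_leI)
  also have "\<dots> = ennreal B * emeasure lborel (ball (0::complex) r)"
    by (rule nn_integral_cmult_indicator) simp
  also have "\<dots> = ennreal (B * (pi * r\<^sup>2))"
    using r \<open>0 \<le> B\<close> by (simp add: emeasure_ball unit_ball_vol_2 ennreal_mult)
  finally show ?thesis .
qed

text \<open>In the coordinate \<open>f\<close>, a competitor \<open>F\<close> becomes \<open>(F \<circ> f) f'\<close>. Since \<open>F - 1\<close> vanishes to order
  \<open>n + 1\<close> at \<open>a\<close>, this function agrees with \<open>f'\<close> up to order \<open>n\<close>, whatever \<open>F\<close> is, so the orthogonality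
  of powers bounds its square integral from below by the terms of order \<open>0\<close> and \<open>n\<close> of \<open>f'\<close>.\<close>

lemma minimal_L2_integral_lower_bound:
  fixes q :: "complex \<Rightarrow> complex" and n :: nat
  assumes G: "is_Green_function \<Omega> a G" and \<Omega>: "open \<Omega>" "a \<in> \<Omega>"
    and sl: "sublevel \<Omega> (\<lambda>z. ereal (2 * real (Suc n)) * G z) t = f ` ball 0 r"
    and f: "f holomorphic_on ball 0 r" "inj_on f (ball 0 r)" "f 0 = a" and r: "0 < r"
    and n: "n > 0"
    and q: "q holomorphic_on ball 0 r" "\<And>w. w \<in> ball 0 r \<Longrightarrow> deriv f w = b + w ^ n * q w"
  shows "minimal_L2_integral \<Omega> a (\<lambda>z. ereal (2 * real (Suc n)) * G z) t
    \<ge> ennreal ((cmod b)\<^sup>2 * pi * r\<^sup>2 + (cmod (q 0))\<^sup>2 * radial_moment n (r / 2))"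
proof -
  let ?D = "f ` ball 0 r"
  have D: "open ?D" "a \<in> ?D"
    using open_mapping_thm3[OF f(1) open_ball f(2)] f(3) r by force+
  define p where "p = (\<lambda>w. if w = 0 then deriv f 0 else (f w - f 0) / (w - 0))"
  have p: "p holomorphic_on ball 0 r"
    unfolding p_def by (rule pole_lemma_open[OF f(1)]) simp
  have fp: "f w - a = w * p w" if "w \<in> ball 0 r" for w
    using f(3) by (simp add: p_def)
  have df: "deriv f holomorphic_on ball 0 r" using f(1) by (intro holomorphic_deriv) auto
  show ?thesis
    unfolding minimal_L2_integral_def sl
  proof (rule INF_greatest)
    fix F assume "F \<in> {F. F holomorphic_on ?D \<and> (\<lambda>z. F z - 1) \<in> multiplier_ideal_stalk (\<lambda>z. ereal (2 * real (Suc n)) * G z) a}"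
    then have F: "F holomorphic_on ?D"
      "(\<lambda>z. F z - 1) \<in> multiplier_ideal_stalk (\<lambda>z. ereal (2 * real (Suc n)) * G z) a" by auto
    have "(\<lambda>z. F z - 1) holomorphic_on ?D" using F(1) by (intro holomorphic_intros)
    from multiplier_ideal_Green_imp_vanishing[OF G \<Omega> D this F(2)]
    obtain h where h: "h holomorphic_on ?D" "\<And>z. z \<in> ?D \<Longrightarrow> F z - 1 = (z - a) ^ Suc n * h z" by blast
    define k where "k = (\<lambda>w. q w + w * (p w ^ Suc n * h (f w) * deriv f w))"
    have hf: "(\<lambda>w. h (f w)) holomorphic_on ball 0 r"
      using holomorphic_on_compose[OF f(1) h(1)] by (simp add: o_def)
    have hk: "k holomorphic_on ball 0 r"
      unfolding k_def
      by (intro holomorphic_on_add holomorphic_on_mult holomorphic_on_power holomorphic_on_ident q(1) p df hf)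
    have k_eq: "F (f w) * deriv f w = b + w ^ n * k w" if w: "w \<in> ball 0 r" for w
    proof -
      have "F (f w) - 1 = (w * p w) ^ Suc n * h (f w)"
        using h(2)[OF imageI[OF w]] unfolding fp[OF w] .
      then have "F (f w) = 1 + (w * p w) ^ Suc n * h (f w)"
        by (simp only: diff_eq_eq add.commute)
      then have "F (f w) * deriv f w = deriv f w + (w * p w) ^ Suc n * h (f w) * deriv f w"
        by (simp add: algebra_simps)
      also have "\<dots> = (b + w ^ n * q w) + w ^ n * (w * (p w ^ Suc n * h (f w) * deriv f w))"
        using q(2)[OF w] by (simp add: power_mult_distrib mult_ac)
      also have "\<dots> = b + w ^ n * k w" by (simp add: k_def algebra_simps)
      finally show ?thesis .
    qed
    \<comment> \<open>\<open>F\<close> is only known on \<open>?D\<close>; its extension by zero is Borel on the whole plane.\<close>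
    define u where "u = (\<lambda>z. (cmod (indicator ?D z *\<^sub>R F z))\<^sup>2)"
    have "(\<lambda>z. indicator ?D z *\<^sub>R F z) \<in> borel_measurable borel"
      using F(1) D(1) by (intro borel_measurable_continuous_on_indicator holomorphic_on_imp_continuous_on) auto
    then have u: "u \<in> borel_measurable borel" unfolding u_def by measurable
    have "ennreal ((cmod b)\<^sup>2 * pi * r\<^sup>2 + (cmod (q 0))\<^sup>2 * radial_moment n (r / 2))
       \<le> (\<integral>\<^sup>+w\<in>ball 0 r. ennreal ((cmod (b + w ^ n * k w))\<^sup>2) \<partial>lborel)"
      using square_integral_lower_bound[OF hk r n, of b] by (simp add: k_def)
    also have "\<dots> = (\<integral>\<^sup>+w\<in>ball 0 r. ennreal ((cmod (deriv f w))\<^sup>2 * u (f w)) \<partial>lborel)"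
    proof (rule nn_integral_cong)
      fix w :: complex
      show "ennreal ((cmod (b + w ^ n * k w))\<^sup>2) * indicator (ball 0 r) w
          = ennreal ((cmod (deriv f w))\<^sup>2 * u (f w)) * indicator (ball 0 r) w"
      proof (cases "w \<in> ball 0 r")
        case True
        have "(cmod (b + w ^ n * k w))\<^sup>2 = (cmod (deriv f w))\<^sup>2 * u (f w)"
          unfolding k_eq[OF True, symmetric] u_def using True
          by (simp add: norm_mult power_mult_distrib)
        then show ?thesis by simp
      qed auto
    qed
    also have "\<dots> = (\<integral>\<^sup>+z\<in>?D. ennreal (u z) \<partial>lborel)"
      by (rule nn_integral_holomorphic_change_of_variables[symmetric]) (use f u in \<open>auto simp: u_def\<close>)
    also have "\<dots> = (\<integral>\<^sup>+z\<in>?D. ennreal ((cmod (F z))\<^sup>2) \<partial>lborel)"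
      by (intro nn_integral_cong) (auto simp: u_def indicator_def)
    finally show "ennreal ((cmod b)\<^sup>2 * pi * r\<^sup>2 + (cmod (q 0))\<^sup>2 * radial_moment n (r / 2))
       \<le> (\<integral>\<^sup>+z\<in>?D. ennreal ((cmod (F z))\<^sup>2) \<partial>lborel)" .
  qed
qed

section \<open>Domains that are not discs\<close>

text \<open>If \<open>f w = a + b w\<close>, then \<open>G z = ln |z - a| - ln |b|\<close> near \<open>a\<close>.\<close>

lemma Green_coordinate_affine_imp_disc:
  assumes G: "is_Green_function \<Omega> a G" and \<Omega>: "open \<Omega>" "connected \<Omega>" "a \<in> \<Omega>"
    and R: "R > 0" and f: "f holomorphic_on ball 0 R" "inj_on f (ball 0 R)" "f 0 = a" "f ` ball 0 R \<subseteq> \<Omega>"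
    and Gf: "\<And>w. w \<in> ball 0 R - {0} \<Longrightarrow> real_of_ereal (G (f w)) = ln (cmod w)"
    and const: "deriv f constant_on ball 0 R"
  shows "\<exists>c r. \<Omega> = ball c r"
proof -
  define b where "b = deriv f 0"
  have b0: "b \<noteq> 0"
    unfolding b_def using holomorphic_injective_imp_regular[OF f(1) open_ball f(2)] R by simp
  have df: "deriv f w = b" if "w \<in> ball 0 R" for w
    using const that R unfolding constant_on_def b_def by (metis centre_in_ball)
  have f_eq: "f w = a + b * w" if w: "w \<in> ball 0 R" for w
  proof -
    have "\<exists>c. \<forall>x\<in>ball 0 R. f x - b * x = c"
    proof (rule has_field_derivative_zero_constant)
      fix x :: complex assume x: "x \<in> ball 0 R"
      have "(f has_field_derivative b) (at x)"
        using holomorphic_derivI[OF f(1) open_ball x] df[OF x] by simp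
      then have "((\<lambda>x. f x - b * x) has_field_derivative 0) (at x)"
        by (auto intro!: derivative_eq_intros)
      then show "((\<lambda>x. f x - b * x) has_field_derivative 0) (at x within ball 0 R)"
        by (rule has_field_derivative_at_within)
    qed simp
    then obtain c where c: "\<forall>x\<in>ball 0 R. f x - b * x = c" by blast
    from bspec[OF c, of 0] bspec[OF c w] show ?thesis using R f(3) by (simp add: algebra_simps)
  qed
  have mem: "(z - a) / b \<in> ball 0 R - {0}" "f ((z - a) / b) = z"
    if z: "z \<in> ball a (cmod b * R) - {a}" for z
  proof -
    show 1: "(z - a) / b \<in> ball 0 R - {0}"
      using z b0 by (auto simp: norm_divide dist_norm norm_minus_commute field_simps)
    show "f ((z - a) / b) = z" using f_eq[of "(z - a) / b"] 1 b0 by simp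
  qed
  have "\<Omega> = ball a (exp (- (- ln (cmod b))))"
  proof (rule Green_function_radial_imp_disc[OF G \<Omega>])
    show "0 < cmod b * R" using b0 R by simp
    show "ball a (cmod b * R) \<subseteq> \<Omega>"
    proof
      fix z assume z: "z \<in> ball a (cmod b * R)"
      show "z \<in> \<Omega>"
      proof (cases "z = a")
        case False
        then show ?thesis using mem[of z] z f(4) by (metis Diff_iff image_subset_iff singletonD)
      qed (use \<Omega> in auto)
    qed
    fix z assume z: "z \<in> ball a (cmod b * R) - {a}"
    have "real_of_ereal (G z) = ln (cmod ((z - a) / b))"
      using Gf[OF mem(1)[OF z]] mem(2)[OF z] by simp
    also have "\<dots> = ln (cmod (z - a)) + - ln (cmod b)"
      using z b0 by (simp add: norm_divide ln_div)
    finally show "real_of_ereal (G z) = ln (cmod (z - a)) + - ln (cmod b)" .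
  qed
  then show ?thesis by blast
qed

theorem theorem1p15:
  fixes \<Omega> :: "complex set" and z\<^sub>0 :: complex and G :: "complex \<Rightarrow> ereal"
  assumes "domain_bounded_by_analytic_curves \<Omega>"
    and "z\<^sub>0 \<in> \<Omega>"
    and "is_Green_function \<Omega> z\<^sub>0 G"
    and "\<nexists>c r. \<Omega> = ball c r"
  shows "\<exists>k::nat. k > 0 \<and>
           \<not> convex_on {0..} (\<lambda>t. - ln (Green_minimal_integral \<Omega> z\<^sub>0 G k t))"
proof -
  have \<Omega>: "open \<Omega>" "connected \<Omega>"
    using assms(1) unfolding domain_bounded_by_analytic_curves_def by auto
  note G = assms(3)
  obtain f R where R: "R > 0" and f: "f holomorphic_on ball 0 R" "inj_on f (ball 0 R)" "f 0 = z\<^sub>0"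
    "f ` ball 0 R \<subseteq> \<Omega>"
    and Gf: "\<And>w. w \<in> ball 0 R - {0} \<Longrightarrow> real_of_ereal (G (f w)) = ln (cmod w)"
    and sub: "\<And>s. exp (- s) \<le> R \<Longrightarrow> {z\<in>\<Omega>. G z < ereal (- s)} = f ` ball 0 (exp (- s))"
  proof (rule Green_function_conformal_coordinate[OF G \<Omega>(1) assms(2)], goal_cases)
    case (1 f R)
    from 1(2-) show thesis by (rule 1(1))
  qed
  define b where "b = deriv f 0"
  have b0: "b \<noteq> 0"
    unfolding b_def using holomorphic_injective_imp_regular[OF f(1) open_ball f(2)] R by simp
  have df: "deriv f holomorphic_on ball 0 R" using f(1) by (intro holomorphic_deriv) auto
  have nc: "\<not> deriv f constant_on ball 0 R"
    using Green_coordinate_affine_imp_disc[OF G \<Omega> assms(2) R f Gf] assms(4) by blast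
  have "\<not> (\<lambda>w. deriv f w - b) constant_on ball 0 R"
  proof
    assume "(\<lambda>w. deriv f w - b) constant_on ball 0 R"
    then obtain y where "\<forall>w\<in>ball 0 R. deriv f w - b = y" unfolding constant_on_def by blast
    then have "\<forall>w\<in>ball 0 R. deriv f w = y + b" by (simp add: diff_eq_eq)
    then show False using nc unfolding constant_on_def by blast
  qed
  note nc' = this
  have hol: "(\<lambda>w. deriv f w - b) holomorphic_on ball 0 R"
    by (rule holomorphic_on_diff[OF df holomorphic_on_const])
  have z: "0 \<in> ball 0 R" "deriv f 0 - b = 0" using R by (auto simp: b_def)
  obtain q r n where n: "0 < n" and r: "0 < r" "ball (0::complex) r \<subseteq> ball 0 R"
    and q: "q holomorphic_on ball 0 r" "\<And>w. w \<in> ball 0 r \<Longrightarrow> deriv f w - b = (w - 0) ^ n * q w"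
      "\<And>w. w \<in> ball 0 r \<Longrightarrow> q w \<noteq> 0"
  proof (rule holomorphic_factor_zero_nonconstant[OF hol open_ball connected_ball z nc'], goal_cases)
    case (1 q r n)
    show thesis by (rule 1(1)[of n r q]) (fact 1(2-))+
  qed
  have q': "deriv f w = b + w ^ n * q w" if "w \<in> ball 0 r" for w
    using q(2)[OF that] by (simp add: algebra_simps)
  have "continuous (at 0) (\<lambda>w. (cmod (deriv f w))\<^sup>2)"
    using holomorphic_on_imp_differentiable_at[OF df open_ball, of 0] R
    by (intro continuous_intros field_differentiable_imp_continuous_at) auto
  then have cont: "\<exists>d>0. \<forall>w. cmod w < d \<longrightarrow> (cmod (deriv f w))\<^sup>2 < (cmod b)\<^sup>2 + e" if "e > 0" for e
    using that unfolding continuous_at_eps_delta b_def by (fastforce simp: dist_norm)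
  obtain d1 where d1: "d1 > 0" "\<And>w. cmod w < d1 \<Longrightarrow> (cmod (deriv f w))\<^sup>2 < (cmod b)\<^sup>2 + 1"
    using cont[of 1] by auto
  \<comment> \<open>Below radius \<open>R'\<close> the factorisation of \<open>f'\<close> holds, \<open>f'\<close> is bounded and \<open>f\<close> describes sublevel sets.\<close>
  define R' where "R' = min (min r d1) R"
  have R': "R' > 0" "R' \<le> r" "R' \<le> d1" "R' \<le> R" using r R d1 by (auto simp: R'_def)
  define N where "N = 2 * real (Suc n)"
  have N: "N > 0" by (simp add: N_def)
  define \<Phi> where "\<Phi> = (\<lambda>z. ereal N * G z)"
  define m where "m = (\<lambda>t. minimal_L2_integral \<Omega> z\<^sub>0 \<Phi> t)"
  have H_eq: "Green_minimal_integral \<Omega> z\<^sub>0 G n t = enn2real (m t)" for t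
    unfolding Green_minimal_integral_def m_def \<Phi>_def N_def by (simp add: add.commute)
  \<comment> \<open>For \<open>t \<ge> T\<close> the sublevel set is the image of the disc of radius \<open>\<rho> t \<le> R'\<close>.\<close>
  define T where "T = max 0 (- N * ln R')"
  define \<rho> where "\<rho> = (\<lambda>t. exp (- (t / N)))"
  have \<rho>0: "\<rho> t > 0" for t by (simp add: \<rho>_def)
  have \<rho>2: "(\<rho> t)\<^sup>2 = exp (- (2 / N) * t)" for t
    unfolding \<rho>_def by (simp flip: exp_of_nat_mult)
  have \<rho>_le: "\<rho> t \<le> x" if "t \<ge> - N * ln x" "x > 0" for t x
  proof -
    have "- (t / N) \<le> ln x" using that N by (simp add: field_simps)
    then have "\<rho> t \<le> exp (ln x)" unfolding \<rho>_def by simp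
    then show ?thesis using that by simp
  qed
  have T0: "T \<ge> 0" by (simp add: T_def)
  have T: "\<rho> t \<le> R'" if "t \<ge> T" for t
    using that \<rho>_le[of R' t] R' by (auto simp: T_def)
  have sl: "sublevel \<Omega> \<Phi> t = f ` ball 0 (\<rho> t)" if "t \<ge> T" for t
    using sub[of "t / N"] T[OF that] R' sublevel_scaled_Green_function[OF G N, of t]
    by (simp add: \<Phi>_def \<rho>_def)
  have f': "f holomorphic_on ball 0 (\<rho> t)" "inj_on f (ball 0 (\<rho> t))" "q holomorphic_on ball 0 (\<rho> t)"
     "\<And>w. w \<in> ball 0 (\<rho> t) \<Longrightarrow> deriv f w = b + w ^ n * q w" if "t \<ge> T" for t
  proof -
    have "ball 0 (\<rho> t) \<subseteq> ball 0 R" "ball 0 (\<rho> t) \<subseteq> ball 0 r" using T[OF that] R' by auto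
    note s = this
    show "f holomorphic_on ball 0 (\<rho> t)" by (rule holomorphic_on_subset[OF f(1) s(1)])
    show "inj_on f (ball 0 (\<rho> t))" by (rule inj_on_subset[OF f(2) s(1)])
    show "q holomorphic_on ball 0 (\<rho> t)" by (rule holomorphic_on_subset[OF q(1) s(2)])
    show "deriv f w = b + w ^ n * q w" if "w \<in> ball 0 (\<rho> t)" for w
      by (rule q'[OF subsetD[OF s(2) that]])
  qed
  have upper: "m t \<le> ennreal (B * (pi * (\<rho> t)\<^sup>2))"
    if "t \<ge> T" "\<And>w. w \<in> ball 0 (\<rho> t) \<Longrightarrow> (cmod (deriv f w))\<^sup>2 \<le> B" for t B
    unfolding m_def
    by (rule minimal_L2_integral_le_area[OF sl[OF that(1)] f'(1,2)[OF that(1)] \<rho>0 that(2)])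
  have fin: "m t < \<infinity>" if "t \<ge> T" for t
  proof -
    have "m t \<le> ennreal (((cmod b)\<^sup>2 + 1) * (pi * (\<rho> t)\<^sup>2))"
    proof (rule upper[OF that])
      fix w :: complex assume "w \<in> ball 0 (\<rho> t)"
      then have "cmod w < d1" using T[OF that] R' by simp
      from d1(2)[OF this] show "(cmod (deriv f w))\<^sup>2 \<le> (cmod b)\<^sup>2 + 1" by simp
    qed
    also have "\<dots> < \<infinity>" by simp
    finally show ?thesis .
  qed
  define A where "A = (cmod b)\<^sup>2 * pi"
  have A: "A > 0" using b0 by (simp add: A_def)
  have low: "enn2real (m t) > A * exp (- (2 / N) * t)" if t: "t \<ge> T" for t
  proof -
    let ?x = "(cmod b)\<^sup>2 * pi * (\<rho> t)\<^sup>2 + (cmod (q 0))\<^sup>2 * radial_moment n (\<rho> t / 2)"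
    have pos: "(cmod (q 0))\<^sup>2 * radial_moment n (\<rho> t / 2) > 0"
      using q(3)[of 0] r radial_moment_pos[of "\<rho> t / 2" n] \<rho>0[of t] by simp
    have "ennreal ?x \<le> m t"
      unfolding m_def \<Phi>_def N_def
      by (rule minimal_L2_integral_lower_bound[OF G \<Omega>(1) assms(2) _ f'(1,2)[OF t] f(3) \<rho>0 n f'(3,4)[OF t]])
        (use sl[OF t] in \<open>auto simp: \<Phi>_def N_def\<close>)
    then have "enn2real (ennreal ?x) \<le> enn2real (m t)"
      using fin[OF t] by (intro enn2real_mono) auto
    moreover have "?x > A * exp (- (2 / N) * t)" "?x \<ge> 0"
      using pos A unfolding A_def \<rho>2[symmetric] by auto
    ultimately show ?thesis by simp
  qed
  have up: "\<exists>t\<ge>T. enn2real (m t) \<le> A' * exp (- (2 / N) * t)" if A': "A' > A" for A'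
  proof -
    define e where "e = (A' - A) / pi"
    have e: "e > 0" "((cmod b)\<^sup>2 + e) * pi = A'" using A' by (simp_all add: e_def A_def field_simps)
    obtain d where d: "d > 0" "\<And>w. cmod w < d \<Longrightarrow> (cmod (deriv f w))\<^sup>2 < (cmod b)\<^sup>2 + e"
      using cont[OF e(1)] by auto
    define t where "t = max T (- N * ln d)"
    have t: "t \<ge> T" "\<rho> t \<le> d" using \<rho>_le[of d t] d by (auto simp: t_def)
    have "m t \<le> ennreal (((cmod b)\<^sup>2 + e) * (pi * (\<rho> t)\<^sup>2))"
    proof (rule upper[OF t(1)])
      fix w :: complex assume "w \<in> ball 0 (\<rho> t)"
      then have "cmod w < d" using t(2) by simp
      from d(2)[OF this] show "(cmod (deriv f w))\<^sup>2 \<le> (cmod b)\<^sup>2 + e" by simp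
    qed
    also have "((cmod b)\<^sup>2 + e) * (pi * (\<rho> t)\<^sup>2) = A' * exp (- (2 / N) * t)"
      unfolding e(2)[symmetric] \<rho>2[symmetric] by simp
    finally have "enn2real (m t) \<le> enn2real (ennreal (A' * exp (- (2 / N) * t)))"
      by (intro enn2real_mono) auto
    then show ?thesis using t A A' by auto
  qed
  have "\<not> convex_on {0..} (\<lambda>t. - ln (enn2real (m t)))"
    by (rule not_convex_neg_ln_of_exponential_asymptotics[OF A T0 low up])
  then show ?thesis using n by (auto simp: H_eq intro!: exI[of _ n])
qed

end
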